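(* (i) If $\beta>1$ is an algebraic integer with $\mathrm{M}(\beta)<\Theta=\theta_5^{-1}$, then $\beta$ is not a simple Parry number. (ii) Conversely, if $1<\beta<2$ is a simple Parry number such that $\mathrm{M}(P_{\beta,P}/P_\beta)=1$, equivalently such that $P_{\beta,P}(X)/P_\beta(X)$ is a product of cyclotomic polynomials, then $\mathrm{M}(\beta)=\mathrm{M}(P_\beta)=\mathrm{M}(P_{\beta,P})\ge\Theta$.
   Context: $\mathrm{M}$ denotes the Mahler measure; $\Theta=1.3247\ldots$ is the smallest Pisot number (real root of $X^3-X-1$), equal to $\theta_5^{-1}$ where $\theta_5$ is the root in $(0,1)$ of $-1+z+z^5$. For real $\beta>1$, $T_\beta(x)=\{\beta x\}$ and $d_\beta(1)=0.t_1t_2\ldots$ with $t_i=\lfloor\beta T_\beta^{i-1}(1)\rfloor$; $\beta$ is a simple Parry number if $d_\beta(1)=0.t_1\ldots t_m$ is finite with $t_m\ne0$, and then its Parry polynomial is $P_{\beta,P}(X)=X^m-t_1X^{m-1}-\cdots-t_m$, a multiple of the minimal polynomial $P_\beta$ of $\beta$. *)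

theory Defs
  imports Complex_Main "HOL-Computational_Algebra.Computational_Algebra"
    "Berlekamp_Zassenhaus.Mahler_Measure"
begin

text \<open>The smallest Pisot number.\<close>

definition Theta :: real where
  "Theta = (THE x. x ^ 3 - x - 1 = 0)"

text \<open>The root in the open unit interval of the trinomial \<open>-1 + z + z\<^sup>n\<close>.\<close>

definition theta :: "nat \<Rightarrow> real" where
  "theta n = (THE z. 0 < z \<and> z < 1 \<and> -1 + z + z ^ n = 0)"

text \<open>
  Minimal polynomial over the integers, normalised to be primitive (which irreducibility in
  \<open>\<int>[X]\<close> entails, as a constant has no root) with positive leading coefficient; it is monic
  exactly when \<open>\<beta>\<close> is an algebraic integer.  Only meaningful for algebraic \<open>\<beta>\<close>.
\<close>

definition min_poly :: "real \<Rightarrow> int poly" where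
  "min_poly \<beta> = (THE p. Factorial_Ring.irreducible p \<and> lead_coeff p > 0 \<and> poly (map_poly of_int p) \<beta> = 0)"

text \<open>The Mahler measure of a number, as opposed to that of a polynomial
  (\<^const>\<open>mahler_measure\<close>).\<close>

definition mahler :: "real \<Rightarrow> real" where
  "mahler \<beta> = mahler_measure (min_poly \<beta>)"

definition beta_transformation :: "real \<Rightarrow> real \<Rightarrow> real" where
  "beta_transformation \<beta> x = frac (\<beta> * x)"

text \<open>The digits \<open>t\<^sub>i\<close> of the Renyi expansion \<open>d\<^sub>\<beta>(1) = 0.t\<^sub>1t\<^sub>2\<dots>\<close>; meaningful for \<open>i \<ge> 1\<close> only.\<close>

definition renyi_digit :: "real \<Rightarrow> nat \<Rightarrow> int" where
  "renyi_digit \<beta> i = \<lfloor>\<beta> * (beta_transformation \<beta> ^^ (i - 1)) 1\<rfloor>"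

definition renyi_length :: "real \<Rightarrow> nat \<Rightarrow> bool" where
  "renyi_length \<beta> m \<longleftrightarrow> m \<ge> 1 \<and> renyi_digit \<beta> m \<noteq> 0 \<and> (\<forall>i>m. renyi_digit \<beta> i = 0)"

definition simple_Parry :: "real \<Rightarrow> bool" where
  "simple_Parry \<beta> \<longleftrightarrow> \<beta> > 1 \<and> (\<exists>m. renyi_length \<beta> m)"

definition Parry_poly :: "real \<Rightarrow> int poly" where
  "Parry_poly \<beta> = (let m = (THE m. renyi_length \<beta> m)
     in Polynomial.monom 1 m - (\<Sum>i=1..m. Polynomial.monom (renyi_digit \<beta> i) (m - i)))"

definition cyclotomic :: "nat \<Rightarrow> complex poly" where
  "cyclotomic n = (\<Prod>k\<in>{k\<in>{1..n}. Rings.coprime k n}. [:- cis (2 * pi * real k / real n), 1:])"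

text \<open>Repetitions are allowed, and the empty product \<open>1\<close> is included.\<close>

definition product_of_cyclotomics :: "int poly \<Rightarrow> bool" where
  "product_of_cyclotomics q \<longleftrightarrow>
     (\<exists>ns. (\<forall>n\<in>set ns. n \<ge> 1) \<and> map_poly of_int q = (\<Prod>n\<leftarrow>ns. cyclotomic n))"

end

(*
  A root beta > 1 of its Parry polynomial X^m - t_1 X^(m-1) - ... - t_m is the only positive root,
  because the t_i are nonnegative.  Hence 1/beta is not a conjugate of beta, so the minimal polynomial
  P of beta is not reciprocal, and Smyth's theorem gives M(beta) >= Theta.

  For Smyth's theorem, the integer power series A = P(0) P / P*, where P* is the reciprocal polynomial,
  is a quotient f / g of two finite Blaschke products with the same constant coefficient c = 1 / M(P).
  Both act as contractions on coefficient sequences; comparing few coefficients of f = A g and using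
  that A is integral yields c^3 + c^2 <= 1.

  The equivalence in (ii) is Kronecker's theorem together with the Galois invariance of root
  multiplicities.  The latter follows from the power sums s_k: they satisfy s_(kp) = s_k modulo p and
  are bounded, so s_(kp) = s_k for every large prime p.
*)

theory Submission
  imports Defs "HOL-Number_Theory.Residues" "Jordan_Normal_Form.Char_Poly"
begin

hide_const (open) UnivPoly.coeff UnivPoly.monom Module.smult

no_notation vec_index (infixl "$" 100)

section \<open>Contractive power series\<close>

text \<open>Being bounded by 1 on the unit disc is encoded by coefficients alone (Schur): every
  truncated Toeplitz operator of the series is a contraction. Each coefficient inequality is then a
  quadratic form evaluated at a chosen test polynomial \<open>h\<close>.

  The constant arises at index 2k, where k is the first positive index with \<open>A $ k\<close>
  nonzero. Up to exchanging f and g, \<open>A $ k\<close> is positive, and a value of 2 or more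
  bounds c at once; so f and g differ by exactly c at k. If A vanishes strictly between k and 2k,
  integrality leaves \<open>A $ (2 * k)\<close> at least 1 or at most 0, and both cases give c^3 +
  c^2 <= 1, with extreme values g_k = -(1 - c^2) and f_k = 1 - c^2 respectively. For M = 1/c this
  reads M + 1 <= M^3, the cubic of \<open>Theta\<close>.

  In (ii), primitive roots of the same order n are powers z^u of one of them with u coprime to n.
  The congruences of power sums become equalities only for large primes, so u is first moved within
  its class modulo n until all its prime factors are large.\<close>

definition contractive :: "'a::real_normed_field fps \<Rightarrow> bool" where
  "contractive F \<longleftrightarrow>
    (\<forall>h N. (\<Sum>i\<le>N. (norm ((F * h) $ i))\<^sup>2) \<le> (\<Sum>i\<le>N. (norm (h $ i))\<^sup>2))"

lemma contractiveD:
  "contractive F \<Longrightarrow> (\<Sum>i\<le>N. (norm ((F * h) $ i))\<^sup>2) \<le> (\<Sum>i\<le>N. (norm (h $ i))\<^sup>2)"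
  by (simp add: contractive_def)

lemma contractive_mult:
  assumes "contractive F" "contractive G"
  shows "contractive (F * G)"
  unfolding contractive_def mult.assoc
  using order_trans[OF contractiveD[OF assms(1)] contractiveD[OF assms(2)]] by blast

lemma contractive_one: "contractive 1"
  by (simp add: contractive_def)

lemma contractive_const:
  assumes "norm u = 1"
  shows "contractive (fps_const u)"
  using assms by (simp add: contractive_def norm_mult)

lemma contractive_prod_list: "(\<And>F. F \<in> set Fs \<Longrightarrow> contractive F) \<Longrightarrow> contractive (prod_list Fs)"
  by (induction Fs) (auto intro: contractive_mult contractive_one)

text \<open>The expansion at 0 of the Blaschke factor (z - a)/(1 - cnj a z); for |a| = 1 it
  degenerates to the constant -a.\<close>

definition blaschke :: "complex \<Rightarrow> complex fps" where
  "blaschke a = (fps_X - fps_const a) * inverse (1 - fps_const (cnj a) * fps_X)"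

text \<open>With \<open>w = h / (1 - cnj a X)\<close>, the two partial sums of squares differ by a telescoping sum
  equal to \<open>(1 - \<bar>a\<bar>\<^sup>2) \<bar>w\<^sub>N\<bar>\<^sup>2\<close>.\<close>

lemma contractive_blaschke:
  assumes "norm a \<le> 1"
  shows "contractive (blaschke a)"
  unfolding contractive_def
proof (intro allI)
  fix h :: "complex fps" and N
  define w where "w = inverse (1 - fps_const (cnj a) * fps_X) * h"
  have "(1 - fps_const (cnj a) * fps_X) * inverse (1 - fps_const (cnj a) * fps_X) = 1"
    by (subst mult.commute, rule inverse_mult_eq_1) simp
  then have h: "h = (1 - fps_const (cnj a) * fps_X) * w"
    by (simp add: w_def mult.assoc[symmetric])
  have F: "blaschke a * h = (fps_X - fps_const a) * w"
    by (simp add: blaschke_def w_def mult.assoc)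
  have "(\<Sum>i\<le>N. (norm (h $ i))\<^sup>2) - (\<Sum>i\<le>N. (norm ((blaschke a * h) $ i))\<^sup>2)
      = (1 - (norm a)\<^sup>2) * (norm (w $ N))\<^sup>2"
  proof (induction N)
    case 0
    show ?case unfolding F by (simp add: h norm_mult algebra_simps power_mult_distrib)
  next
    case (Suc N)
    have e: "(norm (h $ Suc N))\<^sup>2 - (norm ((blaschke a * h) $ Suc N))\<^sup>2
        = (1 - (norm a)\<^sup>2) * ((norm (w $ Suc N))\<^sup>2 - (norm (w $ N))\<^sup>2)"
      unfolding F
      by (simp add: h left_diff_distrib mult.assoc cmod_power2) 
         (simp add: power2_eq_square algebra_simps)
    show ?case using Suc e by (simp add: algebra_simps)
  qed
  moreover have "(norm a)\<^sup>2 \<le> 1" using assms by (simp add: power_le_one)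
  ultimately show "(\<Sum>i\<le>N. (norm ((blaschke a * h) $ i))\<^sup>2) \<le> (\<Sum>i\<le>N. (norm (h $ i))\<^sup>2)"
    by (smt (verit) mult_nonneg_nonneg zero_le_power2)
qed

text \<open>Against a real \<open>h\<close>, convolution commutes with taking real parts. This leads
  from complex series to real ones, whose coefficients can be compared by order.\<close>

lemma contractive_Re:
  assumes "contractive F"
  shows "contractive (Abs_fps (\<lambda>i. Re (F $ i)))"
  unfolding contractive_def
proof (intro allI)
  fix h :: "real fps" and N
  let ?h = "Abs_fps (\<lambda>i. complex_of_real (h $ i))"
  have "(Abs_fps (\<lambda>i. Re (F $ i)) * h) $ i = Re ((F * ?h) $ i)" for i
    by (simp add: fps_mult_nth)
  then have "(\<Sum>i\<le>N. (norm ((Abs_fps (\<lambda>i. Re (F $ i)) * h) $ i))\<^sup>2)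
      \<le> (\<Sum>i\<le>N. (norm ((F * ?h) $ i))\<^sup>2)"
    by (intro sum_mono) (simp add: cmod_power2)
  also have "\<dots> \<le> (\<Sum>i\<le>N. (norm (?h $ i))\<^sup>2)"
    by (rule contractiveD[OF assms])
  finally show "(\<Sum>i\<le>N. (norm ((Abs_fps (\<lambda>i. Re (F $ i)) * h) $ i))\<^sup>2) \<le> (\<Sum>i\<le>N. (norm (h $ i))\<^sup>2)"
    by simp
qed

text \<open>Test the contraction against the reversal of \<open>h\<close> by Cauchy-Schwarz.\<close>

lemma contractive_square_bound:
  fixes F h :: "real fps"
  assumes "contractive F"
  shows "\<bar>(F * h\<^sup>2) $ N\<bar> \<le> (\<Sum>i\<le>N. (h $ i)\<^sup>2)"
proof -
  have "(F * h\<^sup>2) $ N = ((F * h) * h) $ N" by (simp add: power2_eq_square mult.assoc)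
  also have "\<dots> = (\<Sum>i\<le>N. (F * h) $ i * h $ (N - i))"
    by (simp add: fps_mult_nth atMost_atLeast0)
  finally have e: "(F * h\<^sup>2) $ N = (\<Sum>i\<le>N. (F * h) $ i * h $ (N - i))" .
  have r: "(\<Sum>i\<le>N. (h $ (N - i))\<^sup>2) = (\<Sum>i\<le>N. (h $ i)\<^sup>2)"
    by (rule sum.reindex_bij_witness[of _ "\<lambda>i. N - i" "\<lambda>i. N - i"]) auto
  have "\<bar>\<Sum>i\<le>N. (F * h) $ i * h $ (N - i)\<bar> \<le> (\<Sum>i\<le>N. \<bar>(F * h) $ i * h $ (N - i)\<bar>)"
    by (rule sum_abs)
  also have "\<dots> \<le> (\<Sum>i\<le>N. (((F * h) $ i)\<^sup>2 + (h $ (N - i))\<^sup>2) / 2)"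
  proof (rule sum_mono)
    fix i
    have "0 \<le> (\<bar>(F * h) $ i\<bar> - \<bar>h $ (N - i)\<bar>)\<^sup>2" by simp
    then show "\<bar>(F * h) $ i * h $ (N - i)\<bar> \<le> (((F * h) $ i)\<^sup>2 + (h $ (N - i))\<^sup>2) / 2"
      by (simp add: power2_diff abs_mult)
  qed
  also have "\<dots> = ((\<Sum>i\<le>N. ((F * h) $ i)\<^sup>2) + (\<Sum>i\<le>N. (h $ i)\<^sup>2)) / 2"
    by (simp add: sum_divide_distrib[symmetric] sum.distrib r)
  also have "\<dots> \<le> (\<Sum>i\<le>N. (h $ i)\<^sup>2)"
    using contractiveD[OF assms, where h = h and N = N] by simp
  finally show ?thesis by (simp add: e)
qed

section \<open>Coefficient inequalities from test polynomials\<close>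

lemma contractive_bound2:
  fixes F :: "real fps"
  assumes "contractive F" "k > 0"
  shows "\<bar>F $ k + 2 * x * F $ 0\<bar> \<le> 1 + x\<^sup>2"
proof -
  define h :: "real fps" where "h = 1 + fps_const x * fps_X ^ k"
  have "(F * h\<^sup>2) $ k = F $ k + 2 * x * F $ 0"
  proof -
    have "F * h\<^sup>2 = F + fps_X ^ k * (fps_const (2 * x) * F + fps_X ^ k * (fps_const (x\<^sup>2) * F))"
      by (simp add: h_def power2_eq_square algebra_simps numeral_fps_const flip: fps_const_mult)
    then show ?thesis
      using assms(2) by (simp add: fps_X_power_mult_nth)
  qed
  moreover have "(\<Sum>i\<le>k. (h $ i)\<^sup>2) = (\<Sum>i\<in>{0,k}. (h $ i)\<^sup>2)"
    by (rule sum.mono_neutral_right) (auto simp: h_def)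
  then have "(\<Sum>i\<le>k. (h $ i)\<^sup>2) = 1 + x\<^sup>2"
    using assms(2) by (simp add: h_def)
  ultimately show ?thesis
    using contractive_square_bound[OF assms(1), of h k] by simp
qed

lemma contractive_bound3:
  fixes F :: "real fps"
  assumes "contractive F" "k > 0"
  shows "\<bar>F $ (2 * k) + 2 * x * F $ k + (x\<^sup>2 + 2 * y) * F $ 0\<bar> \<le> 1 + x\<^sup>2 + y\<^sup>2"
proof -
  define h :: "real fps" where "h = 1 + fps_const x * fps_X ^ k + fps_const y * fps_X ^ (2 * k)"
  have "(F * h\<^sup>2) $ (2 * k) = F $ (2 * k) + 2 * x * F $ k + (x\<^sup>2 + 2 * y) * F $ 0"
  proof -
    have X: "fps_X ^ (2 * k) = fps_X ^ k * (fps_X ^ k :: real fps)"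
      by (simp add: mult_2 power_add)
    have "F * h\<^sup>2 = F + fps_X ^ k * (fps_const (2 * x) * F) + fps_X ^ (2 * k) * (fps_const (x\<^sup>2 + 2 * y) * F
        + fps_X ^ k * (fps_const (2 * x * y) * F + fps_X ^ k * (fps_const (y\<^sup>2) * F)))"
      unfolding h_def X
      by (simp add: power2_eq_square algebra_simps numeral_fps_const flip: fps_const_mult fps_const_add)
    then show ?thesis
      using assms(2) by (simp add: fps_X_power_mult_nth)
  qed
  moreover have "(\<Sum>i\<le>2*k. (h $ i)\<^sup>2) = (\<Sum>i\<in>{0,k,2*k}. (h $ i)\<^sup>2)"
    by (rule sum.mono_neutral_right) (auto simp: h_def)
  then have "(\<Sum>i\<le>2*k. (h $ i)\<^sup>2) = 1 + x\<^sup>2 + y\<^sup>2"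
    using assms(2) by (simp add: h_def)
  ultimately show ?thesis
    using contractive_square_bound[OF assms(1), of h "2*k"] by simp
qed

lemma contractive_bound4:
  fixes F :: "real fps"
  assumes "contractive F" "0 < j" "j < k"
  shows "\<bar>F $ (j + k) + 2 * x * F $ k + x\<^sup>2 * F $ (k - j) + 2 * y * F $ j + (2 * x * y + 2 * z) * F $ 0\<bar>
    \<le> 1 + x\<^sup>2 + y\<^sup>2 + z\<^sup>2"
proof -
  define h :: "real fps"
    where "h = 1 + fps_const x * fps_X ^ j + fps_const y * fps_X ^ k + fps_const z * fps_X ^ (j + k)"
  have "(F * h\<^sup>2) $ (j + k) = F $ (j + k) + 2 * x * F $ k + x\<^sup>2 * F $ (k - j) + 2 * y * F $ j
      + (2 * x * y + 2 * z) * F $ 0"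
  proof -
    \<comment> \<open>\<open>R\<close> gathers the terms beyond degree j + k. Since j < k, degree 2k
      lies there, whereas 2j stays below and produces the coefficient at k - j.\<close>
    define R where "R = fps_X ^ (k - j) * (fps_const (y\<^sup>2) * F) + fps_X ^ j * (fps_const (2 * x * z) * F)
        + fps_X ^ k * (fps_const (2 * y * z) * F) + fps_X ^ (j + k) * (fps_const (z\<^sup>2) * F)"
    have X: "fps_X ^ k = fps_X ^ j * (fps_X ^ (k - j) :: real fps)"
      using assms(3) by (simp flip: power_add)
    have "F * h\<^sup>2 = F + fps_X ^ j * (fps_const (2 * x) * F) + fps_X ^ (2 * j) * (fps_const (x\<^sup>2) * F)
        + fps_X ^ k * (fps_const (2 * y) * F) + fps_X ^ (j + k) * (fps_const (2 * x * y + 2 * z) * F + R)"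
      unfolding h_def R_def power_add mult_2 X
      by (simp add: power2_eq_square algebra_simps numeral_fps_const flip: fps_const_mult fps_const_add)
    moreover have "R $ 0 = 0" using assms by (simp add: R_def fps_X_power_mult_nth)
    ultimately show ?thesis
      using assms(2,3) by (simp add: fps_X_power_mult_nth)
  qed
  moreover have "(\<Sum>i\<le>j+k. (h $ i)\<^sup>2) = (\<Sum>i\<in>{0,j,k,j+k}. (h $ i)\<^sup>2)"
    by (rule sum.mono_neutral_right) (auto simp: h_def)
  then have "(\<Sum>i\<le>j+k. (h $ i)\<^sup>2) = 1 + x\<^sup>2 + y\<^sup>2 + z\<^sup>2"
    using assms(2,3) by (simp add: h_def)
  ultimately show ?thesis
    using contractive_square_bound[OF assms(1), of h "j+k"] by simp
qed

text \<open>The free parameter is optimal at x = F_0 for the upper and at x = -F_0 for the lower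
  estimate.\<close>

lemma contractive_coeff_le:
  fixes F :: "real fps"
  assumes "contractive F" "k > 0"
  shows "\<bar>F $ k\<bar> \<le> 1 - (F $ 0)\<^sup>2"
  using contractive_bound2[OF assms, of "F $ 0"] contractive_bound2[OF assms, of "- (F $ 0)"]
  by (simp add: power2_eq_square abs_le_iff)

text \<open>The parameters of \<open>contractive_bound3\<close> are set to the minimisers of the
  resulting quadratics: y = c and x = F_k / (1 - c) for the upper estimate, y = -c and x = -F_k / (1
  + c) for the lower one.\<close>

lemma contractive_coeff_double:
  fixes F :: "real fps"
  assumes F: "contractive F" "k > 0" and c: "c = F $ 0" "0 < c" "c < 1"
  shows "F $ (2 * k) \<le> 1 - c\<^sup>2 - (F $ k)\<^sup>2 / (1 - c)"
    and "- F $ (2 * k) \<le> 1 - c\<^sup>2 - (F $ k)\<^sup>2 / (1 + c)"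
proof -
  define x where "x = F $ k / (1 - c)"
  have "F $ (2 * k) \<le> 1 - c\<^sup>2 + (x\<^sup>2 * (1 - c) - 2 * x * F $ k)"
    using contractive_bound3[OF F, of x c] by (simp add: c(1) power2_eq_square algebra_simps abs_le_iff)
  also have "x\<^sup>2 * (1 - c) - 2 * x * F $ k = - ((F $ k)\<^sup>2 / (1 - c))"
    using c by (simp add: x_def power2_eq_square divide_simps)
  finally show "F $ (2 * k) \<le> 1 - c\<^sup>2 - (F $ k)\<^sup>2 / (1 - c)" by simp
next
  define x where "x = - F $ k / (1 + c)"
  have "- F $ (2 * k) \<le> 1 - c\<^sup>2 + (x\<^sup>2 * (1 + c) + 2 * x * F $ k)"
    using contractive_bound3[OF F, of x "- c"] by (simp add: c(1) power2_eq_square algebra_simps abs_le_iff)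
  also have "x\<^sup>2 * (1 + c) + 2 * x * F $ k = - ((F $ k)\<^sup>2 / (1 + c))"
    using c by (simp add: x_def power2_eq_square divide_simps)
  finally show "- F $ (2 * k) \<le> 1 - c\<^sup>2 - (F $ k)\<^sup>2 / (1 + c)" by simp
qed

lemma square_ge_tangent: "2 * x * x0 - x0\<^sup>2 \<le> (x::real)\<^sup>2"
  using zero_le_power2[of "x - x0"] by (simp add: power2_diff)

text \<open>The left side is convex in d, hence above its tangent at the endpoint d = -(1 - c^2),
  and that tangent is nondecreasing. At the endpoint the two sides differ by (c^3 + c^2 - 1)/(1 -
  c): this is the origin of the cubic.\<close>

lemma double_coeff_gap:
  fixes c d :: real
  assumes c: "c < 1" "c ^ 3 + c\<^sup>2 > 1" "c > 0" and d: "d \<ge> - (1 - c\<^sup>2)"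
  shows "c + d + (c + d)\<^sup>2 / (1 - c) + d\<^sup>2 / (1 + c) > 2 * (1 - c\<^sup>2)"
proof -
  define q where "q = 1 - c\<^sup>2"
  define y where "y = d + q"
  have q: "q = (1 - c) * (1 + c)" by (simp add: q_def power2_eq_square algebra_simps)
  have "c ^ 3 \<le> c" using c power_decreasing[of 1 3 c] by simp
  then have e0: "c - q > 0" using c by (simp add: q_def)
  have chalf: "c > 1/2"
  proof (rule ccontr)
    assume "\<not> c > 1/2"
    then have "c\<^sup>2 \<le> (1/2)\<^sup>2" "c \<le> 1/2" using c by (auto intro!: power_mono)
    with e0 show False by (simp add: q_def power2_eq_square)
  qed
  have y: "y \<ge> 0" using d by (simp add: y_def q_def)
  have "(2 * (c + d) * (c - q) - (c - q)\<^sup>2) / (1 - c) \<le> (c + d)\<^sup>2 / (1 - c)"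
    by (intro divide_right_mono square_ge_tangent) (use c in auto)
  moreover have "(2 * d * (- q) - (- q)\<^sup>2) / (1 + c) \<le> d\<^sup>2 / (1 + c)"
    by (intro divide_right_mono square_ge_tangent) (use c in auto)
  moreover have "(2 * d * (- q) - (- q)\<^sup>2) / (1 + c) = - 2 * d * (1 - c) - (1 - c) * q"
  proof -
    have "2 * d * (- q) - (- q)\<^sup>2 = (- 2 * d * (1 - c) - (1 - c) * q) * (1 + c)"
      unfolding q by (simp add: power2_eq_square algebra_simps)
    then show ?thesis using c(3) by simp
  qed
  moreover have "(2 * (c + d) * (c - q) - (c - q)\<^sup>2) / (1 - c) + Z > 0"
    if Z: "Z = c + d - 2 * d * (1 - c) - (1 - c) * q - 2 * q" for Z
  proof -
    have "(2 * (c + d) * (c - q) - (c - q)\<^sup>2) + Z * (1 - c)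
        = (c ^ 3 + c\<^sup>2 - 1) + y * ((1 - c) * (2 * c - 1) + 2 * (c - q))"
      unfolding y_def q_def Z by (simp add: power2_eq_square power3_eq_cube algebra_simps)
    moreover have "y * ((1 - c) * (2 * c - 1) + 2 * (c - q)) \<ge> 0"
      using y chalf c(1) e0 by (intro mult_nonneg_nonneg add_nonneg_nonneg) auto
    ultimately have "((2 * (c + d) * (c - q) - (c - q)\<^sup>2) + Z * (1 - c)) / (1 - c) > 0"
      using c(1,2) by (intro divide_pos_pos) auto
    then show ?thesis using c(1) by (simp only: add_divide_distrib) simp
  qed
  note this[OF refl]
  ultimately show ?thesis unfolding q_def[symmetric] by linarith
qed

lemma cube_plus_square_le:
  assumes "0 < c" "c \<le> 75475/100000"
  shows "c ^ 3 + c\<^sup>2 \<le> (1::real)"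
proof -
  have "c ^ 3 \<le> (75475/100000) ^ 3" "c\<^sup>2 \<le> (75475/100000)\<^sup>2" using assms by (intro power_mono; simp)+
  then show ?thesis by (simp add: power2_eq_square power3_eq_cube)
qed

lemma fps_mult_nth_sparse:
  fixes A g :: "real fps"
  assumes "0 < k" "k < n" "A $ 0 = 1" "\<And>i. 0 < i \<Longrightarrow> i < n \<Longrightarrow> i \<noteq> k \<Longrightarrow> A $ i = 0"
  shows "(A * g) $ n = g $ n + A $ k * g $ (n - k) + A $ n * g $ 0"
proof -
  have "(A * g) $ n = (\<Sum>i\<in>{0,k,n}. A $ i * g $ (n - i))"
    unfolding fps_mult_nth by (rule sum.mono_neutral_right) (use assms in auto)
  then show ?thesis using assms by simp
qed

text \<open>Using opposite y and z for f and g makes their y and z terms add up in the difference,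
  while the common x leaves only f_k - g_k and cancels the x^2 terms.\<close>

lemma contractive_pair_bound:
  fixes f g :: "real fps"
  assumes f: "contractive f" and g: "contractive g" and jk: "0 < j" "j < k"
    and eq: "f $ j = g $ j" "f $ (k - j) = g $ (k - j)" "f $ 0 = g $ 0"
  shows "\<bar>(f $ (j + k) - g $ (j + k)) + 2 * x * (f $ k - g $ k) + 4 * y * g $ j + 4 * (x * y + z) * g $ 0\<bar>
    \<le> 2 * (1 + x * x + y * y + z * z)"
proof -
  have "(f $ (j + k) - g $ (j + k)) + 2 * x * (f $ k - g $ k) + 4 * y * g $ j + 4 * (x * y + z) * g $ 0
      = (f $ (j + k) + 2 * x * f $ k + x\<^sup>2 * f $ (k - j) + 2 * y * f $ j + (2 * x * y + 2 * z) * f $ 0)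
      - (g $ (j + k) + 2 * x * g $ k + x\<^sup>2 * g $ (k - j) + 2 * (- y) * g $ j + (2 * x * (- y) + 2 * (- z)) * g $ 0)"
    unfolding eq by (simp add: ring_distribs)
  also have "\<bar>\<dots>\<bar> \<le> (1 + x\<^sup>2 + y\<^sup>2 + z\<^sup>2) + (1 + x\<^sup>2 + (- y)\<^sup>2 + (- z)\<^sup>2)"
    by (rule order_trans[OF abs_triangle_ineq4 add_mono[OF contractive_bound4[OF f jk] contractive_bound4[OF g jk]]])
  finally show ?thesis by (simp add: power2_eq_square)
qed

text \<open>The multipliers approximate the eigenvectors, for the largest and the smallest eigenvalue, of the
  symmetric matrix of the bound at the least favourable value of \<open>s\<close>.\<close>

lemma pair_bound_estimate:
  fixes s a c :: real
  assumes bound: "\<And>x y z. \<bar>(s + a) + 2 * x * c + 4 * y * s + 4 * (x * y + z) * c\<bar>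
      \<le> 2 * (1 + x * x + y * y + z * z)"
    and "c \<le> a"
  shows "c \<le> 75475/100000"
proof -
  have "1.72 * s + 4.3872 * c + a \<le> 3.71"
    using bound[of "0.51" "0.18" "0.75", THEN abs_le_D1] by simp
  moreover have "11.1344 * c - a - 5.56 * s \<le> 8.7994"
    using bound[of "-1.24" "1.14" "-0.75", THEN abs_le_D2] by simp
  \<comment> \<open>5.56 times the first bound plus 1.72 times the second eliminates
    \<open>s\<close> and leaves \<open>a\<close> with the positive weight 3.84, so \<open>a\<close>
    may be replaced by its lower bound \<open>c\<close>.\<close>
  ultimately show ?thesis using assms(2) by simp
qed

lemma Ints_ge_1_or_le_0: "x \<in> \<int> \<Longrightarrow> x \<ge> 1 \<or> x \<le> (0::real)"
  by (elim Ints_cases) (simp, linarith)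

text \<open>
  Let \<open>k\<close> be the first index with \<open>A\<^sub>k \<noteq> 0\<close>, so that \<open>f\<close> and \<open>g\<close> agree below \<open>k\<close>.  If \<open>A\<close> vanishes strictly
  between \<open>k\<close> and \<open>2k\<close>, the coefficients at \<open>k\<close> and \<open>2k\<close> give the sharp bound.  Otherwise, with \<open>l\<close> the
  next index where \<open>A\<close> does not vanish and \<open>j = l - k\<close>, the coefficients at \<open>j\<close>, \<open>k\<close> and \<open>l\<close> even give
  \<open>c \<le> 0.75475\<close>, which is only slightly below the root \<open>0.754877\<dots>\<close> of \<open>c\<^sup>3 + c\<^sup>2 = 1\<close>.
\<close>

lemma schur_quotient_bound_pos:
  fixes f g A :: "real fps"
  assumes f: "contractive f" and g: "contractive g"
    and c: "f $ 0 = c" "g $ 0 = c" "c > 0"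
    and fAg: "f = A * g" and A: "\<And>i. A $ i \<in> \<int>" "A $ 0 = 1"
    and k: "k > 0" "\<And>i. 0 < i \<Longrightarrow> i < k \<Longrightarrow> A $ i = 0" "A $ k > 0"
  shows "c ^ 3 + c\<^sup>2 \<le> 1"
proof (rule ccontr)
  assume contr: "\<not> c ^ 3 + c\<^sup>2 \<le> 1"
  have low: "f $ i = g $ i" if "i < k" for i
  proof -
    have "(A * g) $ i = (\<Sum>n\<in>{0}. A $ n * g $ (i - n))"
      unfolding fps_mult_nth by (rule sum.mono_neutral_right) (use that k in auto)
    then show ?thesis using fAg A by simp
  qed
  have fk: "f $ k = g $ k + A $ k * c"
  proof -
    have "(A * g) $ k = (\<Sum>n\<in>{0,k}. A $ n * g $ (k - n))"
      unfolding fps_mult_nth by (rule sum.mono_neutral_right) (use k in auto)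
    then show ?thesis using fAg A k c by simp
  qed
  have bf: "\<bar>f $ k\<bar> \<le> 1 - c\<^sup>2" and bg: "\<bar>g $ k\<bar> \<le> 1 - c\<^sup>2"
    using contractive_coeff_le[OF f k(1)] contractive_coeff_le[OF g k(1)] c by auto
  have "A $ k * c > 0" using k(3) c(3) by simp
  then have "c\<^sup>2 < 1\<^sup>2" using bf bg fk by simp
  then have c1: "c < 1" using c(3) by (simp add: power_less_imp_less_base)
  \<comment> \<open>A jump of at least 2c between two numbers of modulus at most 1 - c^2 gives c <=
    1 - c^2, hence c^3 + c^2 <= 1 because c^3 <= c.\<close>
  have "A $ k = 1"
  proof (rule ccontr)
    assume "A $ k \<noteq> 1"
    moreover obtain a where "A $ k = of_int a" using A(1) Ints_cases by blast
    ultimately have "A $ k \<ge> 2" using k(3) by simp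
    then have "A $ k * c \<ge> 2 * c" using c by simp
    then have "c \<le> 1 - c\<^sup>2" using fk bf bg by simp
    moreover have "c ^ 3 \<le> c" using c c1 power_decreasing[of 1 3 c] by simp
    ultimately show False using contr by simp
  qed
  with fk have fk: "f $ k = g $ k + c" by simp
  show False
  proof (cases "\<exists>l. k < l \<and> l < 2 * k \<and> A $ l \<noteq> 0")
    case False
    have f2: "f $ (2 * k) = g $ (2 * k) + g $ k + A $ (2 * k) * c"
      unfolding fAg using fps_mult_nth_sparse[of k "2 * k" A g] k False A(2) \<open>A $ k = 1\<close> c
      by (metis (no_types, lifting) add_diff_cancel_left' mult_1 mult_2 less_add_same_cancel1 nat_neq_iff)
    note Bf = contractive_coeff_double[OF f k(1) c(1)[symmetric] c(3) c1]
    note Bg = contractive_coeff_double[OF g k(1) c(2)[symmetric] c(3) c1]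
    \<comment> \<open>The two cases mirror each other under replacing (f, g) by (-g, -f):
      \<open>double_coeff_gap\<close> is used with d = g_k in the first and d = -f_k in the
      second.\<close>
    from Ints_ge_1_or_le_0[OF A(1)[of "2 * k"]] show False
    proof
      assume "A $ (2 * k) \<ge> 1"
      then have "A $ (2 * k) * c \<ge> c" using c by simp
      moreover have "c + g $ k + (c + g $ k)\<^sup>2 / (1 - c) + (g $ k)\<^sup>2 / (1 + c) > 2 * (1 - c\<^sup>2)"
        using double_coeff_gap[of c "g $ k"] c c1 contr bg by simp
      moreover have "f $ k = c + g $ k" using fk by simp
      ultimately show False using Bf(1) Bg(2) f2 by simp
    next
      assume "A $ (2 * k) \<le> 0"
      then have "A $ (2 * k) * c \<le> 0" using c by (simp add: mult_nonpos_nonneg)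
      moreover have "c + - f $ k + (c + - f $ k)\<^sup>2 / (1 - c) + (- f $ k)\<^sup>2 / (1 + c) > 2 * (1 - c\<^sup>2)"
        using double_coeff_gap[of c "- f $ k"] c c1 contr bf by simp
      moreover have "c + - f $ k = - g $ k" using fk by simp
      ultimately show False using Bf(2) Bg(1) f2 by simp
    qed
  next
    case True
    define l where "l = (LEAST l. k < l \<and> l < 2 * k \<and> A $ l \<noteq> 0)"
    have l: "k < l" "l < 2 * k" "A $ l \<noteq> 0"
      using LeastI_ex[OF True] by (auto simp: l_def)
    have least: "A $ i = 0" if "k < i" "i < l" for i
      using not_less_Least[of i "\<lambda>l. k < l \<and> l < 2 * k \<and> A $ l \<noteq> 0"] that l by (auto simp: l_def)
    \<comment> \<open>As j < k, the series f and g agree at j and at k - j; besides c, only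
      \<open>g $ j\<close> and the integer \<open>A $ l\<close> remain in the bound.\<close>
    define j where "j = l - k"
    have j: "0 < j" "j < k" "l = j + k" using l by (auto simp: j_def)
    have fl: "f $ (j + k) = g $ (j + k) + g $ j + A $ l * c"
      unfolding fAg using fps_mult_nth_sparse[of k "j + k" A g] k least A(2) \<open>A $ k = 1\<close> c j
      by (metis add_diff_cancel_right' mult_1 less_add_same_cancel2 nat_neq_iff)
    have fj: "f $ j = g $ j" and fkj: "f $ (k - j) = g $ (k - j)" using low j k by auto
    have bound: "\<bar>(g $ j + A $ l * c) + 2 * x * c + 4 * y * g $ j + 4 * (x * y + z) * c\<bar>
        \<le> 2 * (1 + x * x + y * y + z * z)" for x y z
      using contractive_pair_bound[OF f g j(1,2) fj fkj, of x y z] c fk fl by simp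
    have "c \<le> 75475/100000"
    proof (cases "A $ l \<ge> 1")
      case True
      then have "c \<le> A $ l * c" using c by simp
      with bound show ?thesis by (rule pair_bound_estimate)
    next
      case False
      obtain a where "A $ l = of_int a" using A(1) Ints_cases by blast
      with False l have "A $ l \<le> -1" by simp
      then have "A $ l * c \<le> - 1 * c" using c by (intro mult_right_mono) auto
      then have "c \<le> - (A $ l * c)" by simp
      \<comment> \<open>Changing the signs of \<open>g $ j\<close>, x and z reduces a negative
        \<open>A $ l\<close> to the positive case.\<close>
      moreover have "\<bar>(- g $ j + - (A $ l * c)) + 2 * x * c + 4 * y * (- g $ j) + 4 * (x * y + z) * c\<bar>
          \<le> 2 * (1 + x * x + y * y + z * z)" for x y z
      proof -
        have "(- g $ j + - (A $ l * c)) + 2 * x * c + 4 * y * (- g $ j) + 4 * (x * y + z) * c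
            = - ((g $ j + A $ l * c) + 2 * (- x) * c + 4 * y * g $ j + 4 * ((- x) * y + (- z)) * c)"
          by (simp add: ring_distribs)
        then show ?thesis using bound[of "- x" y "- z"] by (simp only: abs_minus_cancel) simp
      qed
      ultimately show ?thesis by (intro pair_bound_estimate)
    qed
    with contr cube_plus_square_le c show False by blast
  qed
qed

section \<open>Smyth's theorem\<close>

text \<open>Solving for the coefficients of \<open>H\<close> one after another never divides, since
  \<open>G\<close> has constant term 1. It serves both the quotient \<open>A\<close> and the power
  sums.\<close>

lemma Ints_fps_quotient:
  fixes H G :: "'a::comm_ring_1 fps"
  assumes "\<And>i. (H * G) $ i \<in> \<int>" "\<And>i. G $ i \<in> \<int>" "G $ 0 = 1"
  shows "H $ n \<in> \<int>"
proof (induction n rule: less_induct)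
  case (less n)
  have "{0..n} = insert n {..<n}" by auto
  then have "(H * G) $ n = H $ n + (\<Sum>i<n. H $ i * G $ (n - i))"
    by (simp add: fps_mult_nth assms(3))
  then have "H $ n = (H * G) $ n - (\<Sum>i<n. H $ i * G $ (n - i))" by simp
  also have "\<dots> \<in> \<int>" using less assms by (intro Ints_diff Ints_sum Ints_mult) auto
  finally show ?case .
qed

lemma schur_quotient_bound:
  fixes f g A :: "real fps"
  assumes f: "contractive f" and g: "contractive g"
    and c: "f $ 0 = c" "g $ 0 = c" "c > 0"
    and fAg: "f = A * g" and A: "\<And>i. A $ i \<in> \<int>" "A $ 0 = 1" "A \<noteq> 1"
  shows "c ^ 3 + c\<^sup>2 \<le> 1"
proof -
  define k where "k = (LEAST k. k > 0 \<and> A $ k \<noteq> 0)"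
  have ex: "\<exists>k. k > 0 \<and> A $ k \<noteq> 0"
  proof (rule ccontr)
    assume "\<not> ?thesis"
    then have "A $ i = 1 $ i" for i using A(2) by (cases i) auto
    then have "A = 1" by (rule fps_ext)
    with A(3) show False by simp
  qed
  have k: "k > 0" "A $ k \<noteq> 0" using LeastI_ex[OF ex] by (auto simp: k_def)
  have least: "A $ i = 0" if "0 < i" "i < k" for i
    using not_less_Least[of i "\<lambda>k. k > 0 \<and> A $ k \<noteq> 0"] that by (auto simp: k_def)
  show ?thesis
  proof (cases "A $ k > 0")
    case True
    with schur_quotient_bound_pos[OF f g c fAg A(1,2) k(1) least] show ?thesis by blast
  next
    case False
    \<comment> \<open>Exchanging f and g replaces A by its inverse, whose first nonzero coefficient
      after the constant one has the opposite sign.\<close>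
    define B where "B = inverse A"
    have BA: "B * A = 1" unfolding B_def using A(2) by (intro inverse_mult_eq_1) simp
    have gBf: "g = B * f" by (simp add: fAg BA mult.assoc[symmetric])
    have B0: "B $ 0 = 1" using BA A(2) by (metis fps_mult_nth_0 fps_one_nth mult.right_neutral)
    have B: "B $ i \<in> \<int>" for i
      by (rule Ints_fps_quotient[of B A]) (use A in \<open>auto simp: BA\<close>)
    have Bi: "B $ i = - A $ i" if "0 < i" "i \<le> k" for i
    proof -
      have "(B * A) $ i = (\<Sum>n\<in>{0,i}. B $ n * A $ (i - n))"
        unfolding fps_mult_nth by (rule sum.mono_neutral_right) (use that least in auto)
      then show ?thesis using that B0 A(2) by (simp add: BA)
    qed
    show ?thesis
      by (rule schur_quotient_bound_pos[OF g f c(2,1,3) gBf B B0 k(1)])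
         (use Bi least k False in auto)
  qed
qed

section \<open>Blaschke factorisation of P / P*\<close>

definition inner_factor :: "complex \<Rightarrow> complex fps" where
  "inner_factor a = (if norm a \<le> 1 then blaschke a else 1)"

text \<open>For |a| > 1 this equals (1 - cnj a X)/(X - a), the reciprocal of the fraction that a
  contributes to P / P*, rewritten through the point 1 / cnj a inside the disc. So roots outside the
  disc enter the denominator g by a contractive factor with constant coefficient of modulus 1 /
  |a|.\<close>

definition outer_factor :: "complex \<Rightarrow> complex fps" where
  "outer_factor a = (if norm a \<le> 1 then 1 else fps_const (cnj a / a) * blaschke (1 / cnj a))"

lemma blaschke_mult: "blaschke a * (1 - fps_const (cnj a) * fps_X) = fps_X - fps_const a"
  unfolding blaschke_def mult.assoc by (subst inverse_mult_eq_1) auto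

lemma factor_relation:
  "inner_factor a * (1 - fps_const (cnj a) * fps_X) = outer_factor a * (fps_X - fps_const a)"
proof (cases "norm a \<le> 1")
  case True
  then show ?thesis by (simp add: inner_factor_def outer_factor_def blaschke_mult)
next
  case False
  then have a: "a \<noteq> 0" by auto
  have e: "fps_X - fps_const a = fps_const (- a) * (1 - fps_const (cnj (1 / cnj a)) * fps_X)"
    using a by (simp add: algebra_simps mult.assoc[symmetric] flip: fps_const_neg)
  have "outer_factor a * (fps_X - fps_const a)
      = fps_const (cnj a / a * (- a)) * (blaschke (1 / cnj a) * (1 - fps_const (cnj (1 / cnj a)) * fps_X))"
    using False unfolding e outer_factor_def
    by (simp add: mult_ac del: fps_const_mult flip: fps_const_mult)
  also have "\<dots> = 1 - fps_const (cnj a) * fps_X"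
    unfolding blaschke_mult using a by (simp add: algebra_simps flip: fps_const_neg)
  finally show ?thesis using False by (simp add: inner_factor_def)
qed

lemma contractive_inner_factor: "contractive (inner_factor a)"
  by (simp add: inner_factor_def contractive_blaschke contractive_one)

lemma contractive_outer_factor: "contractive (outer_factor a)"
  unfolding outer_factor_def
  by (auto intro!: contractive_one contractive_mult contractive_blaschke contractive_const
      simp: norm_divide divide_le_eq)

lemma norm_outer_factor_0: "norm (outer_factor a $ 0) = 1 / max 1 (norm a)"
  by (auto simp: outer_factor_def blaschke_def norm_mult norm_divide divide_simps)

lemma prod_list_relation:
  fixes f g u v :: "'a \<Rightarrow> 'b::comm_monoid_mult"
  assumes "\<And>x. f x * u x = g x * v x"
  shows "(\<Prod>x\<leftarrow>xs. f x) * (\<Prod>x\<leftarrow>xs. u x) = (\<Prod>x\<leftarrow>xs. g x) * (\<Prod>x\<leftarrow>xs. v x)"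
proof (induction xs)
  case (Cons x xs)
  have "(\<Prod>x\<leftarrow>x # xs. f x) * (\<Prod>x\<leftarrow>x # xs. u x) = (f x * u x) * ((\<Prod>x\<leftarrow>xs. f x) * (\<Prod>x\<leftarrow>xs. u x))"
    by (simp add: mult_ac)
  also have "\<dots> = (\<Prod>x\<leftarrow>x # xs. g x) * (\<Prod>x\<leftarrow>x # xs. v x)"
    unfolding assms Cons by (simp add: mult_ac)
  finally show ?case .
qed simp

lemma fps_of_poly_linear_factors:
  "fps_of_poly (\<Prod>a\<leftarrow>as. [:- a, 1:]) = (\<Prod>a\<leftarrow>as. fps_X - fps_const (a::complex))"
proof (induction as)
  case (Cons a as)
  have "fps_of_poly [:- a, 1:] = fps_X - fps_const a"
    by (simp add: fps_of_poly_pCons)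
  then show ?case by (simp only: list.map prod_list.Cons fps_of_poly_mult Cons)
qed simp

lemma reflect_poly_linear_factors:
  "reflect_poly (\<Prod>a\<leftarrow>as. [:- a, 1:]) = (\<Prod>a\<leftarrow>as. [:1, - (a::'a::idom):])"
proof (induction as)
  case (Cons a as)
  have "reflect_poly [:- a, 1:] = [:1, - a:]"
    by (rule poly_eqI) (auto simp: coeff_reflect_poly coeff_pCons split: nat.splits)
  then show ?case unfolding list.map prod_list.Cons reflect_poly_mult Cons by simp
qed simp

lemma fps_of_poly_reciprocal_factors:
  "fps_of_poly (\<Prod>a\<leftarrow>as. [:1, - a:]) = (\<Prod>a\<leftarrow>as. 1 - fps_const (a::'a::comm_ring_1) * fps_X)"
proof (induction as)
  case (Cons a as)
  have "fps_of_poly [:1, - a:] = 1 - fps_const a * fps_X"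
    by (simp add: fps_of_poly_pCons mult.commute)
  then show ?case by (simp only: list.map prod_list.Cons fps_of_poly_mult Cons)
qed simp

lemma prod_list_cnj_factors_nth:
  "(\<Prod>a\<leftarrow>as. 1 - fps_const (cnj a) * fps_X) $ n = cnj ((\<Prod>a\<leftarrow>as. 1 - fps_const a * fps_X) $ n)"
proof (induction as arbitrary: n)
  case (Cons a as)
  show ?case by (simp add: left_diff_distrib mult.assoc Cons)
qed simp

lemma reflect_poly_of_int:
  "reflect_poly (map_poly of_int p) = map_poly (of_int :: int \<Rightarrow> 'a::ring_char_0) (reflect_poly p)"
  by (rule poly_eqI) (simp add: coeff_reflect_poly coeff_map_poly)

lemma smyth_nonreciprocal:
  fixes p :: "int poly"
  assumes monic: "lead_coeff p = 1" and unit: "\<bar>coeff p 0\<bar> = 1"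
    and nonrec: "reflect_poly p \<noteq> smult (coeff p 0) p"
  shows "mahler_measure p + 1 \<le> mahler_measure p ^ 3"
proof -
  define P where "P = map_poly complex_of_int p"
  define as where "as = complex_roots_complex P"
  define e where "e = complex_of_int (coeff p 0)"
  define M where "M = mahler_measure p"
  have ee: "e * e = 1" using unit unfolding e_def
    by (smt (verit) abs_minus_cancel mult_minus1 of_int_1 of_int_minus mult_1 mult_minus_left minus_minus)
  have ne: "norm e = 1" using unit by (simp add: e_def)
  have P: "P = (\<Prod>a\<leftarrow>as. [:- a, 1:])"
    using complex_roots(1)[of P] monic by (simp add: as_def P_def)
  have M: "M = (\<Prod>a\<leftarrow>as. max 1 (norm a))"
    using monic by (simp add: M_def mahler_measure_def mahler_measure_poly_def as_def P_def)
  have M1: "M \<ge> 1" unfolding M by (rule prod_list_ge1) simp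
  define N where "N = fps_of_poly P"
  define D where "D = fps_of_poly (reflect_poly P)"
  define f where "f = (\<Prod>a\<leftarrow>as. inner_factor a)"
  define g where "g = (\<Prod>a\<leftarrow>as. outer_factor a)"
  have N: "N = (\<Prod>a\<leftarrow>as. fps_X - fps_const a)" 
    unfolding N_def P by (rule fps_of_poly_linear_factors)
  have D_int: "D = fps_of_poly (map_poly of_int (reflect_poly p))"
    by (simp add: D_def P_def reflect_poly_of_int)
  \<comment> \<open>\<open>D\<close> has integer coefficients, so conjugating every root leaves the
    product unchanged.\<close>
  have D: "D = (\<Prod>a\<leftarrow>as. 1 - fps_const (cnj a) * fps_X)"
  proof -
    have D': "D = (\<Prod>a\<leftarrow>as. 1 - fps_const a * fps_X)"
      unfolding D_def P reflect_poly_linear_factors by (rule fps_of_poly_reciprocal_factors)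
    show ?thesis
      by (rule fps_ext) (simp only: prod_list_cnj_factors_nth D'[symmetric], simp add: D_int coeff_map_poly)
  qed
  have D0: "D $ 0 = 1" using monic by (simp add: D_int coeff_map_poly)
  have fg: "f * D = g * N"
    unfolding f_def g_def N D by (rule prod_list_relation) (rule factor_relation)
  define A where "A = fps_const e * N * inverse D"
  have AD: "A * D = fps_const e * N"
    unfolding A_def mult.assoc using D0 by (subst inverse_mult_eq_1) auto
  have A_int: "A $ i \<in> \<int>" for i
  proof (rule Ints_fps_quotient)
    show "(A * D) $ i \<in> \<int>" for i by (simp add: AD N_def P_def coeff_map_poly e_def)
    show "D $ i \<in> \<int>" for i by (simp add: D_int coeff_map_poly)
  qed (rule D0)
  have A0: "A $ 0 = 1"
    using D0 ee by (simp add: A_def N_def P_def coeff_map_poly e_def)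
  have fA: "fps_const e * f = A * g"
  proof -
    have "fps_const e * f * D = A * g * D"
      using fg AD by (metis mult.assoc mult.commute)
    then show ?thesis using D0 by auto
  qed
  have g0: "norm (g $ 0) = 1 / M"
  proof -
    have "norm ((\<Prod>a\<leftarrow>xs. outer_factor a) $ 0) = 1 / (\<Prod>a\<leftarrow>xs. max 1 (norm a))" for xs
      by (induction xs) (simp_all add: norm_mult norm_outer_factor_0)
    then show ?thesis by (simp add: g_def M)
  qed
  \<comment> \<open>Rotates g so that its constant coefficient becomes the positive real 1 / M; f is
    rotated alike, which preserves the quotient A.\<close>
  define u where "u = inverse (sgn (g $ 0))"
  have u: "norm u = 1" "u * g $ 0 = complex_of_real (1 / M)"
  proof -
    have nz: "g $ 0 \<noteq> 0" using g0 M1 by auto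
    then show "norm u = 1" by (simp add: u_def norm_inverse norm_sgn)
    have "u * g $ 0 = of_real (norm (g $ 0))"
      using nz by (simp add: u_def sgn_div_norm scaleR_conv_of_real)
    then show "u * g $ 0 = complex_of_real (1 / M)" by (simp add: g0)
  qed
  define F where "F = fps_const u * (fps_const e * f)"
  define G where "G = fps_const u * g"
  have cF: "contractive F" unfolding F_def f_def
    by (intro contractive_mult contractive_const u ne contractive_prod_list) 
       (auto simp: contractive_inner_factor)
  have cG: "contractive G" unfolding G_def g_def
    by (intro contractive_mult contractive_const u contractive_prod_list) 
       (auto simp: contractive_outer_factor)
  have FAG: "F = A * G" by (simp only: F_def G_def fA mult.left_commute)
  have G0: "G $ 0 = complex_of_real (1 / M)" using u by (simp add: G_def)
  \<comment> \<open>As A is real, taking real parts coefficientwise preserves F = A G.\<close>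
  let ?Re = "\<lambda>F::complex fps. Abs_fps (\<lambda>i. Re (F $ i))"
  have A_Re: "A $ i = of_real (Re (A $ i))" for i
    using A_int[of i] by (auto elim: Ints_cases)
  have ReFAG: "?Re F = ?Re A * ?Re G"
  proof (rule fps_ext)
    fix n
    have "Im (A $ i) = 0" for i by (subst A_Re) simp
    then show "?Re F $ n = (?Re A * ?Re G) $ n"
      by (simp add: FAG fps_mult_nth)
  qed
  have "(1 / M) ^ 3 + (1 / M)\<^sup>2 \<le> 1"
  proof (rule schur_quotient_bound[OF contractive_Re[OF cF] contractive_Re[OF cG] _ _ _ ReFAG])
    show "?Re F $ 0 = 1 / M" "?Re G $ 0 = 1 / M" by (simp_all add: FAG A0 G0)
    show "1 / M > 0" using M1 by simp
    show "?Re A $ i \<in> \<int>" for i using A_int[of i] by (auto elim: Ints_cases)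
    show "?Re A $ 0 = 1" by (simp add: A0)
    \<comment> \<open>A = 1 would say P* = P(0) P, that is, that p is reciprocal up to sign.\<close>
    show "?Re A \<noteq> 1"
    proof
      assume *: "?Re A = 1"
      have "A = 1"
      proof (rule fps_ext)
        fix n
        have "Re (A $ n) = (1::real fps) $ n" using * by (metis fps_nth_Abs_fps)
        then show "A $ n = 1 $ n" using A_Re[of n] by simp
      qed
      then have "D = fps_const e * N" using AD by simp
      then have "map_poly complex_of_int (reflect_poly p) = smult e P"
        unfolding D_int N_def by (simp flip: fps_of_poly_smult)
      also have "\<dots> = map_poly complex_of_int (smult (coeff p 0) p)"
        by (simp add: e_def P_def hom_distribs)
      finally show False using nonrec by simp
    qed
  qed
  then have "M ^ 3 * ((1 / M) ^ 3 + (1 / M)\<^sup>2) \<le> M ^ 3 * 1"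
    using M1 by (intro mult_left_mono) auto
  then show ?thesis
    using M1 unfolding M_def[symmetric] by (simp add: power3_eq_cube power2_eq_square field_simps)
qed

section \<open>Parry polynomials\<close>

lemma int_poly_root_irreducible_factor:
  fixes \<beta> :: real
  assumes "q \<noteq> 0" "poly (map_poly of_int q) \<beta> = 0"
  shows "\<exists>p::int poly. Factorial_Ring.irreducible p \<and> p dvd q \<and> poly (map_poly of_int p) \<beta> = 0"
  using assms
proof (induction q rule: prime_divisors_induct)
  case (unit x)
  then obtain y where "1 = x * y" by (elim dvdE)
  then have "poly (map_poly of_int (x * y)) \<beta> = 1" by (metis of_int_poly_hom.hom_one poly_1)
  with unit show ?case by (simp add: hom_distribs)
next
  case (factor p x)
  show ?case
  proof (cases "poly (map_poly of_int p) \<beta> = 0")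
    case True
    then show ?thesis using factor(1) by (intro exI[of _ p]) (auto simp: prime_elem_imp_irreducible)
  next
    case False
    with factor.prems have "poly (map_poly of_int x) \<beta> = 0" "x \<noteq> 0" by (auto simp: hom_distribs)
    with factor.IH show ?thesis by (meson dvd_mult)
  qed
qed auto

text \<open>Let p be irreducible of least degree among those vanishing at \<open>\<beta>\<close>.
  Pseudo-division of r by p keeps the remainder integral; a nonzero remainder would have an
  irreducible factor of smaller degree with the same root. So p divides a multiple a r, and being
  prime and not constant it divides r. This divisibility also gives the uniqueness behind
  \<open>THE\<close>.\<close>

lemma min_poly_properties:
  fixes \<beta> :: real
  assumes "q \<noteq> 0" "poly (map_poly of_int q) \<beta> = 0"
  shows "lead_coeff (min_poly \<beta>) > 0" "poly (map_poly of_int (min_poly \<beta>)) \<beta> = 0"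
    "\<And>r. poly (map_poly of_int r) \<beta> = 0 \<Longrightarrow> min_poly \<beta> dvd r"
proof -
  define S where "S p \<longleftrightarrow> Factorial_Ring.irreducible p \<and> poly (map_poly of_int p) \<beta> = 0" for p :: "int poly"
  have "\<exists>p. S p" using int_poly_root_irreducible_factor[OF assms] by (auto simp: S_def)
  then obtain p0 where p0: "S p0" and least: "\<And>p. S p \<Longrightarrow> degree p0 \<le> degree p"
    using arg_min_nat_lemma[of S _ degree] by metis
  define p where "p = (if lead_coeff p0 > 0 then p0 else - p0)"
  have nz: "p0 \<noteq> 0" using p0 by (auto simp: S_def)
  have "Factorial_Ring.irreducible (- p0)"
    using p0 irreducible_mult_unit_left[of "- 1" p0] by (simp add: S_def)
  then have Sp: "S p" using p0 by (auto simp: S_def p_def of_int_poly_hom.hom_uminus)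
  have dp: "degree p = degree p0" by (simp add: p_def)
  have lc: "lead_coeff p > 0" using nz by (auto simp: p_def not_less order_le_less)
  have prime: "prime_elem p" using Sp by (auto simp: S_def irreducible_imp_prime_elem)
  have pnz: "p \<noteq> 0" using lc by auto
  have dvd: "p dvd r" if r: "poly (map_poly of_int r) \<beta> = 0" for r
  proof -
    define s where "s = pseudo_mod r p"
    obtain a t where a: "a \<noteq> 0" "Polynomial.smult a r = p * t + s" and s: "s = 0 \<or> degree s < degree p"
      using pseudo_mod[OF pnz, of r] unfolding s_def by blast
    have "poly (map_poly of_int s) \<beta> = 0"
    proof -
      have "poly (map_poly of_int (Polynomial.smult a r)) \<beta> = poly (map_poly of_int (p * t + s)) \<beta>"
        by (simp only: a)
      then show ?thesis using r Sp by (simp add: S_def hom_distribs)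
    qed
    have "s = 0"
    proof (rule ccontr)
      assume "s \<noteq> 0"
      then obtain p' where "S p'" "p' dvd s"
        using int_poly_root_irreducible_factor \<open>poly (map_poly of_int s) \<beta> = 0\<close> by (auto simp: S_def)
      then show False
        using least[of p'] s \<open>s \<noteq> 0\<close> dvd_imp_degree_le[of p' s] dp by linarith
    qed
    then have "p dvd [:a:] * r" using a by simp
    moreover have "\<not> p dvd [:a:]"
    proof
      assume "p dvd [:a:]"
      then have "degree p = 0" using dvd_imp_degree_le[of p "[:a:]"] a by simp
      then obtain b where "p = [:b:]" by (meson degree_eq_zeroE)
      then show False using Sp lc by (simp add: S_def)
    qed
    ultimately show ?thesis using prime_elem_dvd_multD[OF prime] by blast
  qed
  have "min_poly \<beta> = p" unfolding min_poly_def
  proof (rule the_equality)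
    show "Factorial_Ring.irreducible p \<and> lead_coeff p > 0 \<and> poly (map_poly of_int p) \<beta> = 0"
      using Sp lc by (simp add: S_def)
  next
    fix r assume r: "Factorial_Ring.irreducible r \<and> lead_coeff r > 0 \<and> poly (map_poly of_int r) \<beta> = 0"
    with dvd obtain u where u: "r = p * u" by (blast elim: dvdE)
    with r Sp have "u dvd 1" unfolding S_def irreducible_def by blast
    then obtain c where c: "u = [:c:]" "c dvd 1" by (auto simp: is_unit_poly_iff)
    have "lead_coeff r = lead_coeff p * c" by (simp only: u c(1) lead_coeff_mult) simp
    with r lc have "c > 0" by (simp add: zero_less_mult_iff)
    with c have "c = 1" by (simp add: zdvd1_eq)
    with u c show "r = p" by simp
  qed
  with lc Sp dvd show "lead_coeff (min_poly \<beta>) > 0" "poly (map_poly of_int (min_poly \<beta>)) \<beta> = 0"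
    "\<And>r. poly (map_poly of_int r) \<beta> = 0 \<Longrightarrow> min_poly \<beta> dvd r"
    by (auto simp: S_def)
qed

section \<open>The orbit of 1 and the Parry polynomial\<close>

context
  fixes \<beta> :: real and m :: nat
  assumes beta: "\<beta> > 1" and m: "renyi_length \<beta> m"
begin

definition renyi_orbit :: "nat \<Rightarrow> real" where
  "renyi_orbit n = (beta_transformation \<beta> ^^ n) 1"

lemma renyi_orbit_0: "renyi_orbit 0 = 1"
  by (simp add: renyi_orbit_def)

lemma renyi_orbit_Suc: "renyi_orbit (Suc n) = \<beta> * renyi_orbit n - of_int (renyi_digit \<beta> (Suc n))"
  by (simp add: renyi_orbit_def renyi_digit_def beta_transformation_def frac_def)

lemma renyi_orbit_bounds: "0 \<le> renyi_orbit n" "renyi_orbit n \<le> 1"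
  by (cases n; simp add: renyi_orbit_def beta_transformation_def frac_ge_0 less_imp_le[OF frac_lt_1])+

lemma renyi_digit_nonneg: "i \<ge> 1 \<Longrightarrow> renyi_digit \<beta> i \<ge> 0"
  using beta renyi_orbit_bounds(1)[of "i - 1"] by (simp add: renyi_digit_def renyi_orbit_def)

text \<open>The recursion unrolled; at n = m the left side is the Parry polynomial evaluated at
  \<open>\<beta>\<close>.\<close>

lemma renyi_orbit_expansion: "\<beta> ^ n - (\<Sum>i=1..n. of_int (renyi_digit \<beta> i) * \<beta> ^ (n - i)) = renyi_orbit n"
proof (induction n)
  case (Suc n)
  have "(\<Sum>i=1..n. of_int (renyi_digit \<beta> i) * \<beta> ^ (Suc n - i)) = \<beta> * (\<Sum>i=1..n. of_int (renyi_digit \<beta> i) * \<beta> ^ (n - i))"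
    unfolding sum_distrib_left by (rule sum.cong) (auto simp: Suc_diff_le)
  then show ?case by (simp add: renyi_orbit_Suc flip: Suc) (simp add: algebra_simps)
qed (simp add: renyi_orbit_0)

text \<open>After index m all digits vanish, so each step just multiplies by \<open>\<beta>\<close>;
  a positive value would eventually leave the unit interval.\<close>

lemma renyi_orbit_end: "renyi_orbit m = 0"
proof (rule ccontr)
  assume nz: "renyi_orbit m \<noteq> 0"
  have "renyi_orbit (m + n) = \<beta> ^ n * renyi_orbit m" for n
  proof (induction n)
    case (Suc n)
    have "renyi_digit \<beta> (Suc (m + n)) = 0" using m by (simp add: renyi_length_def)
    then show ?case using Suc by (simp add: renyi_orbit_Suc)
  qed simp
  then have "\<beta> ^ n * renyi_orbit m \<le> 1" for n using renyi_orbit_bounds(2)[of "m + n"] by simp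
  moreover obtain n where "\<beta> ^ n > 1 / renyi_orbit m" using real_arch_pow[OF beta] by blast
  moreover have "renyi_orbit m > 0" using nz renyi_orbit_bounds(1)[of m] by simp
  ultimately show False by (metis not_less pos_divide_less_eq)
qed

lemma Parry_poly_eq:
  "Parry_poly \<beta> = Polynomial.monom 1 m - (\<Sum>i=1..m. Polynomial.monom (renyi_digit \<beta> i) (m - i))"
proof -
  have "(THE m. renyi_length \<beta> m) = m"
    using m by (intro the_equality) (auto simp: renyi_length_def, metis nat_neq_iff)
  then show ?thesis by (simp add: Parry_poly_def)
qed

lemma coeff_Parry_poly:
  "coeff (Parry_poly \<beta>) n = (if n = m then 1 else if n < m then - renyi_digit \<beta> (m - n) else 0)"
proof -
  have "coeff (Parry_poly \<beta>) n = (if m = n then 1 else 0) - (\<Sum>i=1..m. if m - i = n then renyi_digit \<beta> i else 0)"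
    by (simp add: Parry_poly_eq coeff_sum)
  also have "(\<Sum>i=1..m. if m - i = n then renyi_digit \<beta> i else 0)
      = (\<Sum>i=1..m. if i = m - n then (if n < m then renyi_digit \<beta> (m - n) else 0) else 0)"
    by (rule sum.cong) auto
  also have "\<dots> = (if n < m then renyi_digit \<beta> (m - n) else 0)"
    by (auto simp: sum.delta)
  finally show ?thesis by auto
qed

lemma monic_Parry_poly: "degree (Parry_poly \<beta>) = m" "lead_coeff (Parry_poly \<beta>) = 1"
proof -
  show "degree (Parry_poly \<beta>) = m"
    by (rule antisym[OF degree_le le_degree]) (auto simp: coeff_Parry_poly)
  then show "lead_coeff (Parry_poly \<beta>) = 1" by (simp add: coeff_Parry_poly)
qed

lemma Parry_poly_0: "coeff (Parry_poly \<beta>) 0 \<noteq> 0"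
  using m by (simp add: coeff_Parry_poly renyi_length_def)

lemma poly_Parry_poly:
  "poly (map_poly of_int (Parry_poly \<beta>)) x = x ^ m - (\<Sum>i=1..m. of_int (renyi_digit \<beta> i) * (x::real) ^ (m - i))"
  by (simp add: Parry_poly_eq hom_distribs poly_monom poly_sum)

lemma Parry_poly_root: "poly (map_poly of_int (Parry_poly \<beta>)) \<beta> = 0"
  using renyi_orbit_expansion[of m] renyi_orbit_end by (simp add: poly_Parry_poly)

text \<open>Divided by x^m, the equation says that the sum of the t_i x^(-i) is 1, and this sum is
  strictly decreasing in x. The proof clears denominators with x^m y^m; strictness comes from the
  index m, where t_m > 0.\<close>

lemma Parry_poly_no_smaller_root:
  fixes x y :: real
  assumes "0 < x" "x < y" "poly (map_poly of_int (Parry_poly \<beta>)) x = 0"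
    "poly (map_poly of_int (Parry_poly \<beta>)) y = 0"
  shows False
proof -
  let ?t = "\<lambda>i. real_of_int (renyi_digit \<beta> i)"
  have "x ^ m * y ^ m = (\<Sum>i=1..m. ?t i * y ^ (m - i) * x ^ m)"
    using assms(4) by (simp add: poly_Parry_poly sum_distrib_right[symmetric])
  also have "\<dots> < (\<Sum>i=1..m. ?t i * x ^ (m - i) * y ^ m)"
  proof (rule sum_strict_mono_ex1)
    have le: "y ^ (m - i) * x ^ m \<le> x ^ (m - i) * y ^ m" if "i \<le> m" for i
    proof -
      have "y ^ (m - i) * x ^ m = (y ^ (m - i) * x ^ (m - i)) * x ^ i" using that by (simp flip: power_add)
      also have "\<dots> \<le> (y ^ (m - i) * x ^ (m - i)) * y ^ i"
        using assms by (intro mult_left_mono power_mono) auto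
      also have "\<dots> = x ^ (m - i) * y ^ m" using that by (simp flip: power_add)
      finally show ?thesis .
    qed
    show "\<forall>i\<in>{1..m}. ?t i * y ^ (m - i) * x ^ m \<le> ?t i * x ^ (m - i) * y ^ m"
      using renyi_digit_nonneg le by (auto simp: mult.assoc intro!: mult_left_mono)
    have "m \<ge> 1" "renyi_digit \<beta> m \<noteq> 0" using m by (auto simp: renyi_length_def)
    then have "?t m > 0" using renyi_digit_nonneg[of m] by simp
    moreover have "x ^ m < y ^ m" using assms \<open>m \<ge> 1\<close> by (intro power_strict_mono) auto
    ultimately have "?t m * y ^ (m - m) * x ^ m < ?t m * x ^ (m - m) * y ^ m" by simp
    with \<open>m \<ge> 1\<close> show "\<exists>i\<in>{1..m}. ?t i * y ^ (m - i) * x ^ m < ?t i * x ^ (m - i) * y ^ m"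
      by (intro bexI[of _ m]) auto
  qed auto
  also have "\<dots> = x ^ m * y ^ m"
    using assms(3) by (simp add: poly_Parry_poly sum_distrib_right[symmetric])
  finally show False by simp
qed

end

section \<open>The constant Theta\<close>

lemma Theta_properties: "Theta ^ 3 - Theta - 1 = 0" "1 < Theta" "Theta < 2"
proof -
  have "\<exists>x\<ge>1. x \<le> 2 \<and> x ^ 3 - x - 1 = (0::real)"
    by (rule IVT') (auto intro!: continuous_intros)
  then obtain x :: real where x: "1 \<le> x" "x \<le> 2" "x ^ 3 - x - 1 = 0" by blast
  have "x \<noteq> 1" "x \<noteq> 2" using x(3) by auto
  then have x1: "1 < x" "x < 2" using x by auto
  have "y = x" if y: "y ^ 3 - y - 1 = 0" for y :: real
  proof -
    have "(y - x) * (y\<^sup>2 + x * y + x\<^sup>2 - 1) = 0"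
      using x(3) y by (simp add: power2_eq_square power3_eq_cube algebra_simps)
    \<comment> \<open>As a quadratic in y the cofactor has minimum 3/4 x^2 - 1, positive because x^2
      = 1 + 1/x > 3/2.\<close>
    moreover have "y\<^sup>2 + x * y + x\<^sup>2 - 1 > 0"
    proof -
      have "x\<^sup>2 = 1 + 1 / x" using x(3) x1 by (simp add: power2_eq_square power3_eq_cube field_simps)
      moreover have "1 / x > 1 / 2" using x1 by (simp add: field_simps)
      ultimately have "3 / 4 * x\<^sup>2 > 1" by simp
      moreover have "y\<^sup>2 + x * y + x\<^sup>2 = (y + x / 2)\<^sup>2 + 3 / 4 * x\<^sup>2"
        by (simp add: power2_eq_square algebra_simps)
      ultimately show ?thesis using zero_le_power2[of "y + x / 2"] by linarith
    qed
    ultimately show ?thesis by simp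
  qed
  then have "Theta = x" unfolding Theta_def by (intro the_equality x(3))
  with x x1 show "Theta ^ 3 - Theta - 1 = 0" "1 < Theta" "Theta < 2" by auto
qed

lemma Theta_le:
  assumes "1 \<le> M" "M + 1 \<le> M ^ 3"
  shows "Theta \<le> M"
proof (rule ccontr)
  assume less: "\<not> Theta \<le> M"
  have "(Theta - M) * (Theta\<^sup>2 + Theta * M + M\<^sup>2 - 1) \<le> 0"
    using assms Theta_properties(1) by (simp add: power2_eq_square power3_eq_cube algebra_simps)
  moreover have "Theta\<^sup>2 \<ge> 1" "Theta * M > 0" using assms Theta_properties by (auto simp: one_le_power)
  then have "Theta\<^sup>2 + Theta * M + M\<^sup>2 - 1 > 0" using zero_le_power2[of M] by linarith
  ultimately show False using less by (simp add: mult_le_0_iff)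
qed

lemma Theta_eq_inverse_theta: "Theta = inverse (theta 5)"
proof -
  let ?z = "inverse Theta"
  note T = Theta_properties
  have z: "0 < ?z" "?z < 1" using T by (auto simp: inverse_less_1_iff)
  have "?z ^ 3 * (Theta ^ 3 - Theta - 1) = (?z * Theta) ^ 3 - ?z\<^sup>2 * (?z * Theta) - ?z ^ 3"
    by (simp only: power2_eq_square power3_eq_cube algebra_simps)
  moreover have "?z * Theta = 1" using T by simp
  ultimately have "?z ^ 3 + ?z\<^sup>2 - 1 = 0" using T(1) by simp
  \<comment> \<open>The cubic factor is, up to sign, the reciprocal of X^3 - X - 1, so 1 /
    \<open>Theta\<close> is a root of the trinomial.\<close>
  moreover have "- 1 + ?z + ?z ^ 5 = (?z\<^sup>2 - ?z + 1) * (?z ^ 3 + ?z\<^sup>2 - 1)"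
    by (simp add: power2_eq_square power3_eq_cube eval_nat_numeral algebra_simps)
  ultimately have root: "- 1 + ?z + ?z ^ 5 = 0" by simp
  have "theta 5 = ?z" unfolding theta_def
  proof (rule the_equality)
    fix y :: real assume y: "0 < y \<and> y < 1 \<and> - 1 + y + y ^ 5 = 0"
    show "y = ?z"
    proof (cases y ?z rule: linorder_cases)
      case less
      then have "y ^ 5 < ?z ^ 5" using y by (intro power_strict_mono) auto
      with less y root show ?thesis by linarith
    next
      case greater
      then have "?z ^ 5 < y ^ 5" using z by (intro power_strict_mono) auto
      with greater y root show ?thesis by linarith
    qed
  qed (use z root in auto)
  then show ?thesis using T by simp
qed

lemma abs_coeff_0_le_mahler_measure:
  assumes "lead_coeff p = 1"
  shows "\<bar>of_int (coeff p 0)\<bar> \<le> mahler_measure p"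
proof -
  define as where "as = complex_roots_complex (map_poly complex_of_int p)"
  have P: "map_poly complex_of_int p = (\<Prod>a\<leftarrow>as. [:- a, 1:])"
    using complex_roots(1)[of "map_poly complex_of_int p"] assms by (simp add: as_def)
  have "norm (poly (\<Prod>a\<leftarrow>xs. [:- a, 1:]) 0) \<le> (\<Prod>a\<leftarrow>xs. max 1 (norm a))" for xs :: "complex list"
  proof (induction xs)
    case (Cons a xs)
    have "norm (poly (\<Prod>a\<leftarrow>a # xs. [:- a, 1:]) 0) = norm a * norm (poly (\<Prod>a\<leftarrow>xs. [:- a, 1:]) 0)"
      by (simp add: norm_mult)
    also have "\<dots> \<le> max 1 (norm a) * (\<Prod>a\<leftarrow>xs. max 1 (norm a))"
      by (intro mult_mono Cons) auto
    finally show ?case by simp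
  qed simp
  from this[of as] have "norm (complex_of_int (coeff p 0)) \<le> mahler_measure p"
    using assms unfolding P[symmetric]
    by (simp add: mahler_measure_def mahler_measure_poly_def as_def poly_0_coeff_0 coeff_map_poly)
  then show ?thesis by simp
qed

lemma simple_Parry_factorization:
  assumes "simple_Parry \<beta>"
  shows "Parry_poly \<beta> = min_poly \<beta> * (Parry_poly \<beta> div min_poly \<beta>)"
    and "lead_coeff (min_poly \<beta>) = 1" "lead_coeff (Parry_poly \<beta> div min_poly \<beta>) = 1"
    and "coeff (min_poly \<beta>) 0 \<noteq> 0" "coeff (Parry_poly \<beta> div min_poly \<beta>) 0 \<noteq> 0"
proof -
  obtain m where beta: "\<beta> > 1" and m: "renyi_length \<beta> m"
    using assms by (auto simp: simple_Parry_def)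
  note monic = monic_Parry_poly[OF beta m]
  have nz: "Parry_poly \<beta> \<noteq> 0" using monic by auto
  note min = min_poly_properties[OF nz Parry_poly_root[OF beta m]]
  have "min_poly \<beta> dvd Parry_poly \<beta>" by (rule min(3)[OF Parry_poly_root[OF beta m]])
  then show eq: "Parry_poly \<beta> = min_poly \<beta> * (Parry_poly \<beta> div min_poly \<beta>)" by simp
  have lc: "lead_coeff (min_poly \<beta>) * lead_coeff (Parry_poly \<beta> div min_poly \<beta>) = 1"
    using monic(2) eq by (metis lead_coeff_mult)
  then show "lead_coeff (min_poly \<beta>) = 1" using min(1) by (metis zmult_eq_1_iff less_minus_one_simps(3) not_less_iff_gr_or_eq zero_less_one)
  with lc show "lead_coeff (Parry_poly \<beta> div min_poly \<beta>) = 1" by simp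
  have "coeff (min_poly \<beta>) 0 * coeff (Parry_poly \<beta> div min_poly \<beta>) 0 \<noteq> 0"
    using Parry_poly_0[OF beta m] eq by (metis coeff_mult_0)
  then show "coeff (min_poly \<beta>) 0 \<noteq> 0" "coeff (Parry_poly \<beta> div min_poly \<beta>) 0 \<noteq> 0" by auto
qed

lemma simple_Parry_mahler_ge:
  assumes "simple_Parry \<beta>"
  shows "Theta \<le> mahler \<beta>"
proof -
  obtain m where beta: "\<beta> > 1" and m: "renyi_length \<beta> m"
    using assms by (auto simp: simple_Parry_def)
  note fac = simple_Parry_factorization[OF assms]
  define p where "p = min_poly \<beta>"
  note p_simps = fac[folded p_def]
  have nz: "Parry_poly \<beta> \<noteq> 0" using monic_Parry_poly[OF beta m] by auto
  have p_root: "poly (map_poly of_int p) \<beta> = 0"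
    unfolding p_def by (rule min_poly_properties(2)[OF nz Parry_poly_root[OF beta m]])
  show ?thesis
  proof (cases "\<bar>coeff p 0\<bar> = 1")
    \<comment> \<open>Here the roots have a product of modulus at least 2 > \<open>Theta\<close>;
      the other case has the unit constant term that Smyth's bound requires.\<close>
    case False
    with p_simps(4) have "\<bar>coeff p 0\<bar> \<ge> 2" by linarith
    then have "real_of_int \<bar>coeff p 0\<bar> \<ge> 2" by linarith
    with abs_coeff_0_le_mahler_measure[OF p_simps(2)] Theta_properties(3) show ?thesis
      by (simp add: mahler_def p_def)
  next
    case True
    have "reflect_poly p \<noteq> Polynomial.smult (coeff p 0) p"
    proof
      assume *: "reflect_poly p = Polynomial.smult (coeff p 0) p"
      let ?P = "map_poly of_int p :: real poly"
      have "poly (reflect_poly ?P) (1 / \<beta>) = (1 / \<beta>) ^ degree ?P * poly ?P \<beta>"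
        using beta by (simp add: poly_reflect_poly_nz inverse_eq_divide)
      then have "poly (map_poly of_int (reflect_poly p)) (1 / \<beta>) = 0"
        using p_root by (simp add: reflect_poly_of_int)
      then have "poly ?P (1 / \<beta>) = 0"
        using p_simps(4) by (simp add: * hom_distribs)
      then have "poly (map_poly of_int (Parry_poly \<beta>)) (1 / \<beta>) = 0"
        by (subst p_simps(1)) (simp add: hom_distribs)
      then show False
        using Parry_poly_no_smaller_root[OF beta m, of "1 / \<beta>" \<beta>] Parry_poly_root[OF beta m] beta
        by (simp add: field_simps less_1_mult)
    qed
    moreover have "p \<noteq> 0" using p_simps(4) by auto
    ultimately show ?thesis
      using smyth_nonreciprocal[OF p_simps(2) True] mahler_measure_poly_ge_1[of p]
      by (intro Theta_le) (auto simp: mahler_def p_def)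
  qed
qed

section \<open>Kronecker's theorem and cyclotomic factors\<close>

lemma sum_list_count:
  fixes f :: "'a \<Rightarrow> 'b::comm_semiring_1"
  assumes "finite Z" "set as \<subseteq> Z"
  shows "(\<Sum>a\<leftarrow>as. f a) = (\<Sum>z\<in>Z. of_nat (count_list as z) * f z)"
  using assms(2)
proof (induction as)
  case (Cons a as)
  have "(\<Sum>z\<in>Z. of_nat (count_list (a # as) z) * f z)
      = (\<Sum>z\<in>Z. of_nat (count_list as z) * f z + (if z = a then f z else 0))"
    by (rule sum.cong) (auto simp: algebra_simps)
  also have "\<dots> = (\<Sum>z\<in>Z. of_nat (count_list as z) * f z) + f a"
    using Cons.prems assms(1) by (simp add: sum.distrib)
  finally show ?case using Cons by (simp add: add.commute)
qed simp

lemma prod_list_count: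
  fixes f :: "'a \<Rightarrow> 'b::comm_monoid_mult"
  assumes "finite Z" "set as \<subseteq> Z"
  shows "(\<Prod>a\<leftarrow>as. f a) = (\<Prod>z\<in>Z. f z ^ count_list as z)"
  using assms(2)
proof (induction as)
  case (Cons a as)
  have "(\<Prod>z\<in>Z. f z ^ count_list (a # as) z)
      = (\<Prod>z\<in>Z. f z ^ count_list as z * (if z = a then f z else 1))"
    by (rule prod.cong) (auto simp: algebra_simps)
  also have "\<dots> = (\<Prod>z\<in>Z. f z ^ count_list as z) * f a"
    using Cons.prems assms(1) by (simp add: prod.distrib)
  finally show ?case using Cons by (simp add: mult.commute)
qed simp

text \<open>A Vandermonde argument: combining the equations with the coefficients of a polynomial
  that vanishes at every f i except f j isolates w j.\<close>

lemma geometric_sequences_independent: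
  fixes f w :: "'i \<Rightarrow> 'a::idom"
  assumes "finite I" "inj_on f I" and zero: "\<And>k. (\<Sum>i\<in>I. w i * f i ^ k) = 0" and j: "j \<in> I"
  shows "w j = 0"
proof -
  define r where "r = (\<Prod>i\<in>I - {j}. [:- f i, 1:])"
  have "(\<Sum>i\<in>I. w i * poly r (f i)) = (\<Sum>i\<in>I. \<Sum>k\<le>degree r. coeff r k * (w i * f i ^ k))"
    by (simp add: poly_altdef sum_distrib_left mult_ac)
  also have "\<dots> = (\<Sum>k\<le>degree r. coeff r k * (\<Sum>i\<in>I. w i * f i ^ k))"
    by (subst sum.swap) (simp add: sum_distrib_left)
  finally have "(\<Sum>i\<in>I. w i * poly r (f i)) = 0" by (simp add: zero)
  moreover have "poly r (f i) = 0" if "i \<in> I" "i \<noteq> j" for i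
    using that assms(1) by (auto simp: r_def poly_prod)
  then have "(\<Sum>i\<in>I. w i * poly r (f i)) = (\<Sum>i\<in>{j}. w i * poly r (f i))"
    by (intro sum.mono_neutral_right) (use assms j in auto)
  moreover have "poly r (f j) \<noteq> 0"
    using assms j by (auto simp: r_def poly_prod inj_on_def)
  ultimately show ?thesis by simp
qed

section \<open>Power sums and Kronecker's theorem\<close>

definition power_sum :: "'a::comm_semiring_1 list \<Rightarrow> nat \<Rightarrow> 'a" where
  "power_sum as k = (\<Sum>a\<leftarrow>as. a ^ k)"

text \<open>The logarithmic derivative of \<open>\<Prod> (1 - a X)\<close>, with the denominator cleared.\<close>

lemma power_sum_fps:
  fixes as :: "'a::comm_ring_1 list"
  defines "D \<equiv> \<lambda>as. \<Prod>a\<leftarrow>as. 1 - fps_const a * fps_X"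
  shows "Abs_fps (power_sum as) * D as = of_nat (length as) * D as - fps_X * fps_deriv (D as)"
proof (induction as)
  case Nil
  show ?case by (rule fps_ext) (simp add: D_def power_sum_def fps_mult_nth)
next
  case (Cons a as)
  define G where "G = Abs_fps (\<lambda>k. a ^ k)"
  have G: "G * (1 - fps_const a * fps_X) = 1"
  proof (rule fps_ext)
    fix n
    have "G * (1 - fps_const a * fps_X) = G - fps_const a * (fps_X * G)"
      by (simp add: algebra_simps)
    then show "(G * (1 - fps_const a * fps_X)) $ n = 1 $ n"
      by (cases n) (simp_all add: G_def)
  qed
  have S: "Abs_fps (power_sum (a # as)) = G + Abs_fps (power_sum as)"
    by (rule fps_ext) (simp add: G_def power_sum_def)
  have D: "D (a # as) = (1 - fps_const a * fps_X) * D as" by (simp add: D_def)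
  have "Abs_fps (power_sum (a # as)) * D (a # as)
      = (G * (1 - fps_const a * fps_X)) * D as + (1 - fps_const a * fps_X) * (Abs_fps (power_sum as) * D as)"
    unfolding S D by (simp add: algebra_simps)
  also have "\<dots> = D as + (1 - fps_const a * fps_X) * (of_nat (length as) * D as - fps_X * fps_deriv (D as))"
    unfolding G Cons by simp
  also have "\<dots> = of_nat (length (a # as)) * D (a # as) - fps_X * fps_deriv (D (a # as))"
    unfolding D by (simp add: algebra_simps)
  finally show ?case .
qed

text \<open>Newton's identities as a generating function: the series of power sums is a quotient of
  integer series whose denominator has constant term 1.\<close>

lemma power_sum_Ints:
  assumes q: "map_poly complex_of_int q = (\<Prod>a\<leftarrow>as. [:- a, 1:])"
  shows "power_sum as k \<in> \<int>"
proof -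
  define D where "D = fps_of_poly (map_poly complex_of_int (reflect_poly q))"
  have D: "D = (\<Prod>a\<leftarrow>as. 1 - fps_const a * fps_X)"
    unfolding D_def reflect_poly_of_int[symmetric] q reflect_poly_linear_factors
    by (rule fps_of_poly_reciprocal_factors)
  have D_int: "D $ n \<in> \<int>" for n by (simp add: D_def coeff_map_poly)
  have D0: "D $ 0 = 1"
    unfolding D by (induction as) (simp_all add: fps_mult_nth)
  have "(Abs_fps (power_sum as) * D) $ n \<in> \<int>" for n
    unfolding power_sum_fps[of as, folded D]
    by (cases n) (auto intro!: Ints_diff Ints_mult Ints_add D_int simp: fps_of_nat[symmetric])
  from Ints_fps_quotient[OF this D_int D0, of k] show ?thesis by simp
qed

lemma norm_power_sum_le:
  fixes as :: "'a::real_normed_field list"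
  assumes "\<forall>a\<in>set as. norm a \<le> 1"
  shows "norm (power_sum as k) \<le> length as"
  using assms
proof (induction as)
  case (Cons a as)
  have "norm (a ^ k) \<le> 1" using Cons.prems by (simp add: norm_power power_le_one)
  then show ?case using Cons norm_triangle_ineq[of "a ^ k" "power_sum as k"]
    by (simp add: power_sum_def)
qed (simp add: power_sum_def)

text \<open>The power sums are bounded integers satisfying a linear recurrence, hence eventually periodic.\<close>

lemma kronecker_roots_of_unity:
  assumes q: "map_poly complex_of_int q = (\<Prod>a\<leftarrow>as. [:- a, 1:])"
    and le: "\<forall>a\<in>set as. norm a \<le> 1" and nz: "0 \<notin> set as"
  shows "\<exists>N>0. \<forall>a\<in>set as. a ^ N = 1"
proof -
  define d where "d = length as"
  define s where "s = power_sum as"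
  define c where "c i = complex_of_int (coeff q i)" for i
  have "degree (map_poly complex_of_int q) = d"
    unfolding q d_def by (subst degree_linear_factors) simp
  then have deg: "degree q = d" by simp
  have lead: "c d = 1"
  proof -
    have "lead_coeff (\<Prod>a\<leftarrow>as. [:- a, 1:]) = (\<Prod>a\<leftarrow>as. lead_coeff [:- a, 1:])"
      by (rule lead_coeff_of_prod)
    also have "\<dots> = 1" by (induction as) simp_all
    finally show ?thesis using deg unfolding q[symmetric] by (simp add: c_def coeff_map_poly)
  qed
  have root: "(\<Sum>i\<le>d. c i * a ^ i) = 0" if "a \<in> set as" for a
  proof -
    have "poly (map_poly complex_of_int q) a = 0"
      unfolding q using that by (auto simp: poly_prod_list prod_list_zero_iff)
    then show ?thesis by (simp add: poly_altdef deg c_def coeff_map_poly)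
  qed
  have rec: "s (n + d) = - (\<Sum>i<d. c i * s (n + i))" for n
  proof -
    have "(\<Sum>i\<le>d. c i * s (n + i)) = (\<Sum>a\<leftarrow>as. a ^ n * (\<Sum>i\<le>d. c i * a ^ i))"
      unfolding s_def power_sum_def
      by (induction as) (simp_all add: sum.distrib sum_distrib_left power_add algebra_simps)
    also have "\<dots> = 0" using root by (simp add: sum_list_0 cong: map_cong)
    finally show ?thesis using lead by (simp add: lessThan_Suc_atMost[symmetric] add_eq_0_iff)
  qed
  define V where "V = complex_of_int ` {- int d..int d}"
  have V: "s k \<in> V" for k
  proof -
    obtain b where b: "s k = of_int b" using power_sum_Ints[OF q] Ints_cases unfolding s_def by blast
    have "norm (s k) \<le> real d" unfolding s_def d_def by (rule norm_power_sum_le[OF le])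
    then have "\<bar>b\<bar> \<le> int d" unfolding b by simp
    then show ?thesis unfolding V_def b by (intro imageI) auto
  qed
  \<comment> \<open>A window of d consecutive power sums takes finitely many values, so one recurs;
    the recurrence of order d then propagates the coincidence.\<close>
  define st where "st n = map (\<lambda>i. s (n + i)) [0..<d]" for n
  have "range st \<subseteq> {xs. set xs \<subseteq> V \<and> length xs = d}"
    using V by (auto simp: st_def)
  moreover have "finite V" by (simp add: V_def)
  ultimately have "finite (range st)"
    using finite_lists_length_eq finite_subset by blast
  then have "\<not> inj st" using finite_imageD infinite_UNIV_nat by blast
  then obtain n m where nm: "n < m" "st n = st m"
    unfolding inj_def by (metis linorder_neqE_nat)
  have per: "s (n + k) = s (m + k)" for k
  proof (induction k rule: less_induct)
    case (less k)
    show ?case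
    proof (cases "k < d")
      case True
      then have "st n ! k = st m ! k" using nm by simp
      then show ?thesis using True by (simp add: st_def)
    next
      case False
      then obtain l where l: "k = l + d" by (metis add.commute le_Suc_ex not_less)
      have "s (n + l + d) = s (m + l + d)"
        unfolding rec using less l by (auto intro!: sum.cong simp: add.assoc)
      then show ?thesis by (simp add: l add.assoc)
    qed
  qed
  \<comment> \<open>Periodicity makes the combination of the sequences a^k with weights mult(a) a^n
    (a^(m-n) - 1) vanish, so by independence every weight is 0.\<close>
  have "a ^ (m - n) = 1" if a: "a \<in> set as" for a
  proof -
    have "of_nat (count_list as a) * (a ^ n * (a ^ (m - n) - 1)) = 0"
    proof (rule geometric_sequences_independent[of "set as" "\<lambda>a. a" "\<lambda>a. of_nat (count_list as a) * (a ^ n * (a ^ (m - n) - 1))"])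
      fix k
      have e: "a ^ n * (a ^ (m - n) - 1) * a ^ k = a ^ (m + k) - a ^ (n + k)" for a :: complex
        using nm by (simp add: algebra_simps power_add[symmetric])
      have "(\<Sum>a\<in>set as. of_nat (count_list as a) * (a ^ n * (a ^ (m - n) - 1)) * a ^ k)
          = (\<Sum>a\<leftarrow>as. a ^ (m + k) - a ^ (n + k))"
        unfolding sum_list_count[OF finite_set subset_refl] mult.assoc by (simp only: e[unfolded mult.assoc])
      also have "\<dots> = s (m + k) - s (n + k)"
        by (simp add: s_def power_sum_def sum_list_subtractf)
      finally show "(\<Sum>a\<in>set as. of_nat (count_list as a) * (a ^ n * (a ^ (m - n) - 1)) * a ^ k) = 0"
        using per by simp
    qed (use a in auto)
    moreover have "count_list as a \<noteq> 0" using a by (simp add: count_list_0_iff)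
    ultimately show ?thesis using a nz by auto
  qed
  then show ?thesis using nm by (intro exI[of _ "m - n"]) auto
qed

section \<open>Galois invariance of root multiplicities\<close>

lemma prime_dvd_freshman:
  fixes a b :: "'a::comm_ring_1"
  assumes "prime p"
  shows "of_nat p dvd (a + b) ^ p - (a ^ p + b ^ p)"
proof -
  have p: "0 < p" using assms prime_gt_0_nat by blast
  have "{..p} = insert 0 (insert p {1..<p})" using p by auto
  then have "(a + b) ^ p - (a ^ p + b ^ p) = (\<Sum>k=1..<p. of_nat (p choose k) * a ^ k * b ^ (p - k))"
    using p by (simp add: binomial_ring)
  also have "of_nat p dvd \<dots>"
  proof (rule dvd_sum)
    fix k assume "k \<in> {1..<p}"
    then have "p dvd (p choose k)" using assms by (intro dvd_choose_prime) auto
    then show "of_nat p dvd of_nat (p choose k) * a ^ k * b ^ (p - k)"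
      by (auto simp: mult.assoc elim!: dvdE)
  qed
  finally show ?thesis .
qed

text \<open>To be applied in the ring \<open>int poly\<close>, where the quotient by p is an integer
  polynomial that can afterwards be evaluated at a root of unity.\<close>

lemma prime_dvd_freshman_sum_list:
  fixes xs :: "'a::comm_ring_1 list"
  assumes "prime p"
  shows "of_nat p dvd (\<Sum>x\<leftarrow>xs. x) ^ p - (\<Sum>x\<leftarrow>xs. x ^ p)"
proof (induction xs)
  case Nil
  then show ?case using prime_gt_0_nat[OF assms] by (simp add: power_0_left)
next
  case (Cons x xs)
  let ?S = "\<Sum>x\<leftarrow>xs. x"
  have "(\<Sum>x\<leftarrow>x # xs. x) ^ p - (\<Sum>x\<leftarrow>x # xs. x ^ p)
      = ((x + ?S) ^ p - (x ^ p + ?S ^ p)) + (?S ^ p - (\<Sum>x\<leftarrow>xs. x ^ p))" by simp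
  moreover have "of_nat p dvd \<dots>"
    by (intro dvd_add prime_dvd_freshman assms Cons)
  ultimately show ?case by (simp only:)
qed

lemma prime_dvd_power_diff:
  fixes s :: int
  assumes "prime p"
  shows "int p dvd s ^ p - s"
proof -
  have p: "p > 0" using assms prime_gt_0_nat by blast
  define n where "n = nat (s mod int p)"
  have n: "int n = s mod int p" using p by (simp add: n_def)
  have "[n ^ p = n] (mod p)"
  proof (cases "p dvd n")
    case True
    then have "p dvd n ^ p" using p by (meson dvd_power dvd_trans)
    with True show ?thesis by (simp add: cong_def mod_0_imp_dvd dvd_imp_mod_0)
  next
    case False
    from fermat_theorem[OF assms False] have "[n * n ^ (p - 1) = n * 1] (mod p)"
      by (rule cong_scalar_left)
    then show ?thesis using p by (simp add: power_eq_if)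
  qed
  then have "[int n ^ p = int n] (mod int p)" by (simp flip: cong_int_iff)
  moreover have "[s = int n] (mod int p)" by (simp add: n cong_def)
  ultimately have "[s ^ p = s] (mod int p)"
    by (meson cong_pow cong_sym cong_trans)
  then show ?thesis by (simp add: cong_iff_dvd_diff)
qed

lemma root_of_unity_power_mod:
  fixes z :: "'a::monoid_mult"
  assumes "z ^ N = 1" "[i = j] (mod N)"
  shows "z ^ i = z ^ j"
proof -
  have red: "z ^ i = z ^ (i mod N)" for i
  proof -
    have "z ^ i = z ^ (N * (i div N) + i mod N)" by simp
    also have "\<dots> = z ^ (i mod N)" unfolding power_add power_mult assms(1) by simp
    finally show ?thesis .
  qed
  from assms(2) red[of i] red[of j] show ?thesis by (simp add: cong_def)
qed

text \<open>The powers of \<open>z\<close> form an eigenvector of an integer circulant matrix with eigenvalue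
  \<open>F(z)\<close>.\<close>

lemma algebraic_int_poly_root_of_unity:
  fixes z :: complex
  assumes N: "N > 0" "z ^ N = 1"
  shows "algebraic_int (poly (map_poly of_int F) z)"
proof -
  define w where "w = poly (map_poly of_int F) z"
  \<comment> \<open>Row i lists the coefficients of X^i F reduced modulo X^N - 1.\<close>
  define B where "B = mat N N (\<lambda>(i, j). \<Sum>l\<le>degree F. if (i + l) mod N = j then coeff F l else 0)"
  define v where "v = vec N (\<lambda>j. z ^ j)"
  let ?B = "map_mat complex_of_int B"
  have B: "B \<in> carrier_mat N N" "?B \<in> carrier_mat N N" by (auto simp: B_def)
  have red: "z ^ (i mod N) = z ^ i" for i
    by (rule root_of_unity_power_mod[OF N(2)]) (simp add: cong_def)
  have w: "w = (\<Sum>l\<le>degree F. of_int (coeff F l) * z ^ l)"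
    by (simp add: w_def poly_altdef coeff_map_poly)
  have "?B *\<^sub>v v = w \<cdot>\<^sub>v v"
  proof (rule eq_vecI)
    fix i assume "i < dim_vec (w \<cdot>\<^sub>v v)"
    then have i: "i < N" by (simp add: v_def)
    have "vec_index (?B *\<^sub>v v) i = (\<Sum>j<N. of_int (\<Sum>l\<le>degree F. if (i + l) mod N = j then coeff F l else 0) * z ^ j)"
      using i by (simp add: B_def v_def scalar_prod_def atLeast0LessThan)
    also have "\<dots> = (\<Sum>j<N. \<Sum>l\<le>degree F. if (i + l) mod N = j then of_int (coeff F l) * z ^ j else 0)"
      by (auto simp: sum_distrib_right intro!: sum.cong)
    also have "\<dots> = (\<Sum>l\<le>degree F. \<Sum>j<N. if (i + l) mod N = j then of_int (coeff F l) * z ^ j else 0)"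
      by (rule sum.swap)
    also have "\<dots> = (\<Sum>l\<le>degree F. of_int (coeff F l) * z ^ (i + l))"
      using N(1) by (simp add: red)
    also have "\<dots> = w * z ^ i"
      by (simp add: w sum_distrib_left power_add mult_ac)
    finally show "vec_index (?B *\<^sub>v v) i = vec_index (w \<cdot>\<^sub>v v) i" using i by (simp add: v_def)
  qed (simp add: B_def v_def)
  moreover have "v \<noteq> 0\<^sub>v N"
  proof
    assume "v = 0\<^sub>v N"
    then have "vec_index v 0 = 0" using N by simp
    then show False using N by (simp add: v_def)
  qed
  moreover have "v \<in> carrier_vec (dim_row ?B)" by (simp add: v_def B_def)
  ultimately have "eigenvalue ?B w"
    unfolding eigenvalue_def eigenvector_def using B by auto
  then have "poly (char_poly ?B) w = 0" using eigenvalue_root_char_poly[OF B(2)] by simp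
  then have "poly (map_poly of_int (char_poly B)) w = 0"
    by (simp only: of_int_hom.char_poly_hom[OF B(1)])
  moreover have "lead_coeff (char_poly B) = 1" using degree_monic_char_poly[OF B(1)] by simp
  ultimately show ?thesis unfolding w_def[symmetric] algebraic_int_altdef_ipoly by blast
qed

text \<open>Write the roots as powers of one z and lift their k-th powers to monomials in Z[X]; then
  s_k^p - s_(kp) = p W(z) with W in Z[X]. The value W(z) is rational and an algebraic integer, hence
  an integer. By Fermat p divides s_k - s_(kp), which has modulus at most 2 \<open>length as\<close>
  < p.\<close>

lemma power_sum_prime:
  assumes q: "map_poly complex_of_int q = (\<Prod>a\<leftarrow>as. [:- a, 1:])"
    and N: "N > 0" "\<forall>a\<in>set as. a ^ N = 1"
    and p: "prime p" "2 * length as < p"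
  shows "power_sum as (k * p) = power_sum as k"
proof -
  define z where "z = cis (2 * pi / N)"
  have zN: "z ^ N = 1" using N by (simp add: z_def DeMoivre)
  have "\<exists>r. a = z ^ r" if "a \<in> set as" for a
  proof -
    have "a \<in> (\<lambda>k. cis (2 * pi * real k / real N)) ` {..<N}"
      using that N bij_betw_imp_surj_on[OF bij_betw_roots_unity[OF N(1)]] by auto
    then show ?thesis by (auto simp: z_def DeMoivre mult_ac)
  qed
  then obtain r where r: "\<And>a. a \<in> set as \<Longrightarrow> a = z ^ r a" by metis
  define ev where "ev F = poly (map_poly complex_of_int F) z" for F
  have ev_sum: "ev (\<Sum>a\<leftarrow>xs. f a) = (\<Sum>a\<leftarrow>xs. ev (f a))" for f and xs :: "complex list"
    by (induction xs) (simp_all add: ev_def hom_distribs)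
  have ev_diff: "ev (F - G) = ev F - ev G" and ev_power: "ev (F ^ n) = ev F ^ n"
    and ev_mult: "ev (F * G) = ev F * ev G" for F G n
    by (simp_all add: ev_def hom_distribs)
  define f where "f a = (Polynomial.monom 1 (r a * k) :: int poly)" for a
  have ev_f: "ev (f a) = a ^ k" if "a \<in> set as" for a
    using r[OF that] by (simp add: ev_def f_def hom_distribs poly_monom power_mult)
  obtain W where W: "(\<Sum>a\<leftarrow>as. f a) ^ p - (\<Sum>a\<leftarrow>as. f a ^ p) = of_nat p * W"
    using prime_dvd_freshman_sum_list[OF p(1), of "map f as"] by (auto simp: o_def elim!: dvdE)
  have "ev ((\<Sum>a\<leftarrow>as. f a) ^ p - (\<Sum>a\<leftarrow>as. f a ^ p)) = power_sum as k ^ p - power_sum as (k * p)"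
    unfolding ev_diff ev_power ev_sum power_sum_def
    by (simp add: ev_f power_mult cong: map_cong)
  moreover have "ev (of_nat p * W) = of_nat p * ev W"
    unfolding ev_mult by (simp add: ev_def hom_distribs)
  ultimately have eW: "power_sum as k ^ p - power_sum as (k * p) = of_nat p * ev W"
    unfolding W by simp
  obtain a where a: "power_sum as k = of_int a"
    using power_sum_Ints[OF q] Ints_cases by blast
  obtain b where b: "power_sum as (k * p) = of_int b"
    using power_sum_Ints[OF q] Ints_cases by blast
  have "p > 0" using p by simp
  have "ev W = of_int (a ^ p - b) / of_int (int p)"
    using eW \<open>p > 0\<close> by (simp add: a b field_simps)
  then have "ev W \<in> \<rat>" by (simp only: Rats_divide Rats_of_int)
  moreover have "algebraic_int (ev W)"
    unfolding ev_def by (rule algebraic_int_poly_root_of_unity[OF N(1) zN])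
  ultimately obtain c where "ev W = of_int c"
    using rational_algebraic_int_is_int Ints_cases by blast
  then have "complex_of_int (a ^ p - b) = of_int (int p * c)"
    using eW by (simp add: a b)
  then have "int p dvd a ^ p - b" by (simp only: of_int_eq_iff) simp
  then have dvd: "int p dvd a - b"
    using dvd_diff[OF _ prime_dvd_power_diff[OF p(1), of a], of "a ^ p - b"] by simp
  have le: "\<forall>a\<in>set as. norm a \<le> 1"
    using N by (metis norm_one norm_power power_eq_1_iff order_refl norm_ge_zero less_numeral_extra(3))
  have "\<bar>a\<bar> \<le> int (length as)" "\<bar>b\<bar> \<le> int (length as)"
    using norm_power_sum_le[OF le, of k] norm_power_sum_le[OF le, of "k * p"] unfolding a b
    by simp_all
  then have "\<bar>a - b\<bar> < int p" using p(2) by linarith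
  then have "a = b" using dvd by (metis dvd_imp_le_int abs_of_nat eq_iff_diff_eq_0 not_less)
  then show ?thesis by (simp add: a b)
qed

lemma power_sum_large_primes:
  assumes q: "map_poly complex_of_int q = (\<Prod>a\<leftarrow>as. [:- a, 1:])"
    and N: "N > 0" "\<forall>a\<in>set as. a ^ N = 1"
    and m: "m > 0" "\<And>p. prime p \<Longrightarrow> p dvd m \<Longrightarrow> 2 * length as < p"
  shows "power_sum as (k * m) = power_sum as k"
  using m
proof (induction m arbitrary: k rule: prime_divisors_induct)
  case (factor p m)
  have "power_sum as (k * (p * m)) = power_sum as ((k * p) * m)" by (simp add: mult_ac)
  also have "\<dots> = power_sum as (k * p)"
    using factor.prems by (intro factor.IH) auto
  also have "\<dots> = power_sum as k"
    using factor.hyps factor.prems(2) by (intro power_sum_prime[OF q N]) auto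
  finally show ?case .
qed auto

text \<open>Since m is coprime to N, raising to the power m permutes the N-th roots of unity.
  Reindexing s_k along it writes s_k and s_(km) as combinations of the same geometric sequences, and
  independence equates the multiplicities.\<close>

lemma count_list_power_large_primes:
  assumes q: "map_poly complex_of_int q = (\<Prod>a\<leftarrow>as. [:- a, 1:])"
    and N: "N > 0" "\<forall>a\<in>set as. a ^ N = 1"
    and m: "m > 0" "\<And>p. prime p \<Longrightarrow> p dvd m \<Longrightarrow> 2 * length as < p \<and> N < p"
    and z: "z ^ N = 1"
  shows "count_list as (z ^ m) = count_list as z"
proof -
  define U where "U = {z::complex. z ^ N = 1}"
  have U: "finite U" "set as \<subseteq> U" "z \<in> U"
    using N z by (auto simp: U_def finite_roots_unity)
  have "Rings.coprime m N"
  proof (rule ccontr)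
    assume "\<not> Rings.coprime m N"
    then obtain p where p: "prime p" "p dvd m" "p dvd N"
      by (metis coprime_iff_gcd_eq_1 dvd_trans gcd_dvd1 gcd_dvd2 prime_factor_nat)
    then have "p \<le> N" using N by (simp add: dvd_imp_le)
    with m(2)[OF p(1,2)] show False by simp
  qed
  then obtain v where v: "[m * v = Suc 0] (mod N)" using cong_solve_coprime_nat by blast
  have inj: "inj_on (\<lambda>z. z ^ m) U"
  proof (rule inj_on_inverseI[where g = "\<lambda>y. y ^ v"])
    fix y assume "y \<in> U"
    then show "(y ^ m) ^ v = y"
      using root_of_unity_power_mod[OF _ v, of y] by (simp add: U_def power_mult)
  qed
  have "(\<lambda>z. z ^ m) ` U \<subseteq> U"
    by (auto simp: U_def power_mult[symmetric] mult.commute[of m]) (simp add: power_mult)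
  then have bij: "bij_betw (\<lambda>z. z ^ m) U U"
    using U(1) inj by (simp add: bij_betw_def endo_inj_surj)
  have "of_nat (count_list as (z ^ m)) - of_nat (count_list as z) = (0::complex)"
  proof (rule geometric_sequences_independent[OF U(1) inj _ U(3), of "\<lambda>z. of_nat (count_list as (z ^ m)) - of_nat (count_list as z)"])
    fix k
    have "(\<Sum>y\<in>U. of_nat (count_list as (y ^ m)) * (y ^ m) ^ k) = (\<Sum>y\<in>U. of_nat (count_list as y) * y ^ k)"
      by (rule sum.reindex_bij_betw[OF bij])
    also have "\<dots> = power_sum as k"
      unfolding power_sum_def by (rule sum_list_count[OF U(1,2), symmetric])
    also have "\<dots> = power_sum as (k * m)"
      using m by (intro power_sum_large_primes[OF q N, symmetric]) auto
    also have "\<dots> = (\<Sum>y\<in>U. of_nat (count_list as y) * (y ^ m) ^ k)"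
      unfolding power_sum_def sum_list_count[OF U(1,2)] by (simp add: power_mult[symmetric] mult.commute[of k])
    finally show "(\<Sum>y\<in>U. (of_nat (count_list as (y ^ m)) - of_nat (count_list as y)) * (y ^ m) ^ k) = 0"
      by (simp add: left_diff_distrib sum_subtractf)
  qed
  then show ?thesis by simp
qed

text \<open>An exponent \<open>u\<close> coprime to \<open>n\<close> is congruent modulo \<open>n\<close> to one all of whose prime factors
  are large.\<close>

lemma count_list_coprime_power:
  assumes q: "map_poly complex_of_int q = (\<Prod>a\<leftarrow>as. [:- a, 1:])"
    and N: "N > 0" "\<forall>a\<in>set as. a ^ N = 1"
    and n: "n > 0" "z ^ n = 1" and u: "Rings.coprime u n"
  shows "count_list as (z ^ u) = count_list as z"
proof -
  define B where "B = max (2 * length as) (N * n)"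
  \<comment> \<open>Each prime up to \<open>B\<close> divides exactly one of u and n * t: a prime
    divisor of u divides neither n nor t, and any other divides t. So none divides m. The bound
    includes N * n, a common exponent for z and all the roots.\<close>
  define S where "S = {p. prime p \<and> p \<le> B \<and> \<not> p dvd u}"
  define t where "t = \<Prod>S"
  define m where "m = u + n * t"
  have S: "finite S" unfolding S_def by (rule finite_subset[of _ "{..B}"]) auto
  have "t > 0" unfolding t_def by (rule prod_pos) (auto simp: S_def prime_gt_0_nat)
  then have m: "m > 0" using n by (simp add: m_def)
  have large: "B < p" if p: "prime p" "p dvd m" for p
  proof (rule ccontr)
    assume "\<not> B < p"
    then have pB: "p \<le> B" by simp
    show False
    proof (cases "p dvd u")
      case True
      then have "p dvd n * t" using p(2) by (simp add: m_def dvd_add_right_iff)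
      moreover have "\<not> p dvd n" using True u p(1) by (metis coprime_common_divisor not_prime_unit)
      ultimately have "p dvd t" using p(1) by (simp add: prime_dvd_mult_iff)
      then obtain l where "l \<in> S" "p dvd l"
        using prime_dvd_prod_iff[OF S p(1), of "\<lambda>x. x"] by (auto simp: t_def)
      then have "p = l" using p(1) by (simp add: S_def primes_dvd_imp_eq)
      with \<open>l \<in> S\<close> True show False by (simp add: S_def)
    next
      case False
      then have "p \<in> S" using p(1) pB by (simp add: S_def)
      then have "p dvd t" using dvd_prodI[OF S, of p "\<lambda>x. x"] by (simp add: t_def)
      then have "p dvd u" using p(2) by (simp add: m_def dvd_add_left_iff)
      with False show False by simp
    qed
  qed
  have "z ^ m = z ^ u * (z ^ n) ^ t" by (simp add: m_def power_add power_mult)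
  then have "z ^ m = z ^ u" by (simp add: n)
  moreover have "count_list as (z ^ m) = count_list as z"
  proof (rule count_list_power_large_primes[OF q _ _ m])
    show "N * n > 0" using N n by simp
    show "\<forall>a\<in>set as. a ^ (N * n) = 1" using N(2) by (simp add: power_mult)
    show "z ^ (N * n) = 1" using n(2) by (simp add: mult.commute[of N] power_mult)
    show "2 * length as < p \<and> N * n < p" if "prime p" "p dvd m" for p
      using large[OF that] by (simp add: B_def)
  qed
  ultimately show ?thesis by simp
qed

section \<open>Grouping roots of unity by their order\<close>

lemma cis_eq_imp_eq:
  assumes "cis (2 * pi * x) = cis (2 * pi * y)" "0 < x" "x \<le> 1" "0 < y" "y \<le> 1"
  shows "x = y"
proof -
  have "cis (2 * pi * x - 2 * pi * y) = 1" using assms(1) by (simp add: cis_divide[symmetric])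
  then have "cos (2 * pi * (x - y)) = 1"
    by (metis cis.sel(1) one_complex.sel(1) right_diff_distrib)
  then obtain i :: int where "2 * pi * (x - y) = of_int i * 2 * pi"
    using cos_one_2pi_int by blast
  then have "x - y = of_int i" by simp
  moreover have "\<bar>x - y\<bar> < 1" using assms by linarith
  ultimately have "i = 0" by linarith
  with \<open>x - y = of_int i\<close> show "x = y" by simp
qed

text \<open>A root of unity corresponds to a fraction in (0, 1]; in lowest terms its denominator is
  the exact order.\<close>

lemma bij_betw_primitive_roots:
  assumes N: "N > 0"
  shows "bij_betw (\<lambda>(n, k). cis (2 * pi * real k / real n))
    (SIGMA n:{n. n dvd N}. {k\<in>{1..n}. Rings.coprime k n}) {z. z ^ N = 1}"
  unfolding bij_betw_def
proof (intro conjI subset_antisym subsetI)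
  show "inj_on (\<lambda>(n, k). cis (2 * pi * real k / real n)) (SIGMA n:{n. n dvd N}. {k\<in>{1..n}. Rings.coprime k n})"
  proof (rule inj_onI, clarify)
    fix n k n' k' :: nat
    assume *: "cis (2 * pi * real k / real n) = cis (2 * pi * real k' / real n')"
      and k: "k \<in> {1..n}" "Rings.coprime k n" "k' \<in> {1..n'}" "Rings.coprime k' n'"
    have "real k / real n = real k' / real n'"
      by (rule cis_eq_imp_eq) (use * k in auto)
    then have "real (k * n') = real (k' * n)" using k by (simp add: divide_simps)
    then have "k * n' = k' * n" by (simp only: of_nat_eq_iff)
    then show "n = n' \<and> k = k'"
      using k(2,4) by (simp add: coprime_crossproduct_nat coprime_commute)
  qed
next
  fix z assume "z \<in> (\<lambda>(n, k). cis (2 * pi * real k / real n)) ` (SIGMA n:{n. n dvd N}. {k\<in>{1..n}. Rings.coprime k n})"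
  then obtain n k where z: "z = cis (2 * pi * real k / real n)" "n dvd N" "k \<in> {1..n}" by auto
  have "z ^ n = cis (2 * pi * real k)" using z by (simp add: DeMoivre)
  also have "\<dots> = cis (2 * pi) ^ k" by (simp only: DeMoivre mult_ac)
  also have "\<dots> = 1" by simp
  finally show "z \<in> {z. z ^ N = 1}" using z(2) by (auto simp: power_mult elim!: dvdE)
next
  fix z :: complex assume "z \<in> {z. z ^ N = 1}"
  then obtain r where r: "r < N" "z = cis (2 * pi * real r / real N)"
    using bij_betw_imp_surj_on[OF bij_betw_roots_unity[OF N]] by blast
  show "z \<in> (\<lambda>(n, k). cis (2 * pi * real k / real n)) ` (SIGMA n:{n. n dvd N}. {k\<in>{1..n}. Rings.coprime k n})"
  proof (cases "r = 0")
    \<comment> \<open>Numerators start at 1, so the root 1 is the fraction 1/1 and not 0.\<close>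
    case True
    then show ?thesis using r by (intro image_eqI[of _ _ "(1, 1)"]) auto
  next
    case False
    define g where "g = gcd r N"
    have g: "g > 0" using False by (simp add: g_def)
    obtain k n where kn: "r = g * k" "N = g * n" by (metis g_def gcd_dvd1 gcd_dvd2 dvdE)
    have "Rings.coprime k n"
      using g kn by (metis g_def gcd_coprime_exists coprime_iff_gcd_eq_1 gcd_mult_distrib_nat mult_cancel1 nat_mult_1_right not_gr_zero)
    moreover have "k \<ge> 1" "k \<le> n" using False r(1) kn g by auto
    moreover have "z = cis (2 * pi * real k / real n)" using r(2) kn g by (simp add: mult.assoc)
    moreover have "n dvd N" using kn by simp
    ultimately show ?thesis by (intro image_eqI[of _ _ "(n, k)"]) auto
  qed
qed

text \<open>Every primitive n-th root is a power of cis (2 pi / n) with exponent coprime to n, so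
  all of them occur in q with the same multiplicity, which becomes the exponent of
  \<open>cyclotomic n\<close>.\<close>

lemma roots_of_unity_product_of_cyclotomics:
  assumes q: "map_poly complex_of_int q = (\<Prod>a\<leftarrow>as. [:- a, 1:])"
    and N: "N > 0" "\<forall>a\<in>set as. a ^ N = 1"
  shows "product_of_cyclotomics q"
proof -
  define U where "U = {z::complex. z ^ N = 1}"
  have U: "finite U" "set as \<subseteq> U"
    using N by (auto simp: U_def finite_roots_unity)
  define c where "c n = count_list as (cis (2 * pi / real n))" for n
  define g where "g = (\<lambda>n k. cis (2 * pi * real k / real n))"
  define D where "D = {n. n dvd N}"
  define C where "C = (\<lambda>n::nat. {k\<in>{1..n}. Rings.coprime k n})"
  have D: "finite D" "\<And>n. n \<in> D \<Longrightarrow> n \<ge> 1"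
    using N by (auto simp: D_def dest: dvd_pos_nat)
  have cnt: "count_list as (g n k) = c n" if "n \<in> D" "k \<in> C n" for n k
  proof -
    have n: "n > 0" using D(2)[OF that(1)] by simp
    have "g n k = cis (2 * pi / real n) ^ k" by (simp add: g_def DeMoivre mult_ac)
    moreover have "cis (2 * pi / real n) ^ n = 1" using n by (simp add: DeMoivre)
    ultimately show ?thesis
      using count_list_coprime_power[OF q N n] that(2) by (simp add: c_def C_def)
  qed
  have cyc: "cyclotomic n = (\<Prod>k\<in>C n. [:- g n k, 1:])" for n
    by (simp add: cyclotomic_def C_def g_def)
  have cyc: "cyclotomic n = (\<Prod>k\<in>C n. [:- g n k, 1:])" for n
    by (simp add: cyclotomic_def C_def g_def)
  have cyc: "cyclotomic n = (\<Prod>k\<in>C n. [:- g n k, 1:])" for n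
    by (simp add: cyclotomic_def C_def g_def)
  have cyc: "cyclotomic n = (\<Prod>k\<in>C n. [:- g n k, 1:])" for n
    by (simp add: cyclotomic_def C_def g_def)
  have cyc: "cyclotomic n = (\<Prod>k\<in>C n. [:- g n k, 1:])" for n
    by (simp add: cyclotomic_def C_def g_def)
  have cyc: "cyclotomic n = (\<Prod>k\<in>C n. [:- g n k, 1:])" for n
    by (simp add: cyclotomic_def C_def g_def)
  have cyc: "cyclotomic n = (\<Prod>k\<in>C n. [:- g n k, 1:])" for n
    by (simp add: cyclotomic_def C_def g_def)
  have cyc: "cyclotomic n = (\<Prod>k\<in>C n. [:- g n k, 1:])" for n
    by (simp add: cyclotomic_def C_def g_def)
  have cyc: "cyclotomic n = (\<Prod>k\<in>C n. [:- g n k, 1:])" for n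
    by (simp add: cyclotomic_def C_def g_def)
  have cyc: "cyclotomic n = (\<Prod>k\<in>C n. [:- g n k, 1:])" for n
    by (simp add: cyclotomic_def C_def g_def)
  have cyc: "cyclotomic n = (\<Prod>k\<in>C n. [:- g n k, 1:])" for n
    by (simp add: cyclotomic_def C_def g_def)
  have cyc: "cyclotomic n = (\<Prod>k\<in>C n. [:- g n k, 1:])" for n
    by (simp add: cyclotomic_def C_def g_def)
  have bij: "bij_betw (\<lambda>(n, k). g n k) (Sigma D C) U"
    unfolding D_def C_def g_def U_def by (rule bij_betw_primitive_roots[OF N(1)])
  have "map_poly of_int q = (\<Prod>z\<in>U. [:- z, 1:] ^ count_list as z)"
    unfolding q by (rule prod_list_count[OF U])
  also have "\<dots> = (\<Prod>(n, k)\<in>Sigma D C. [:- g n k, 1:] ^ count_list as (g n k))"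
    using prod.reindex_bij_betw[OF bij, of "\<lambda>z. [:- z, 1:] ^ count_list as z"]
    by (simp add: case_prod_unfold)
  also have "\<dots> = (\<Prod>n\<in>D. \<Prod>k\<in>C n. [:- g n k, 1:] ^ count_list as (g n k))"
    using D(1) by (subst prod.Sigma) (auto simp: C_def)
  also have "\<dots> = (\<Prod>n\<in>D. cyclotomic n ^ c n)"
    unfolding cyc prod_power_distrib by (intro prod.cong refl) (simp add: cnt)
  also have "\<dots> = (\<Prod>n\<leftarrow>concat (map (\<lambda>n. replicate (c n) n) (sorted_list_of_set D)). cyclotomic n)"
  proof -
    have "(\<Prod>n\<leftarrow>concat (map (\<lambda>n. replicate (c n) n) xs). cyclotomic n) = (\<Prod>n\<leftarrow>xs. cyclotomic n ^ c n)" for xs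
      by (induction xs) simp_all
    then show ?thesis using D(1) prod.distinct_set_conv_list[of "sorted_list_of_set D" "\<lambda>n. cyclotomic n ^ c n"]
      by simp
  qed
  finally show ?thesis
    unfolding product_of_cyclotomics_def using D
    by (intro exI[of _ "concat (map (\<lambda>n. replicate (c n) n) (sorted_list_of_set D))"]) auto
qed

lemma prod_list_max_1_le_1:
  assumes "(\<Prod>a\<leftarrow>as. max 1 (f a)) \<le> (1::real)"
  shows "\<forall>a\<in>set as. f a \<le> 1"
  using assms
proof (induction as)
  case (Cons a as)
  have p: "(\<Prod>a\<leftarrow>as. max 1 (f a)) \<ge> 1" by (rule prod_list_ge1) simp
  have "1 * (\<Prod>a\<leftarrow>as. max 1 (f a)) \<le> max 1 (f a) * (\<Prod>a\<leftarrow>as. max 1 (f a))"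
    using p by (intro mult_right_mono) auto
  moreover have "max 1 (f a) * 1 \<le> max 1 (f a) * (\<Prod>a\<leftarrow>as. max 1 (f a))"
    using p by (intro mult_left_mono) auto
  ultimately have "(\<Prod>a\<leftarrow>as. max 1 (f a)) \<le> 1" "f a \<le> 1" using Cons.prems by simp_all
  with Cons.IH show ?case by simp
qed simp

lemma kronecker_product_of_cyclotomics:
  assumes "lead_coeff q = 1" "coeff q 0 \<noteq> 0" "mahler_measure q = 1"
  shows "product_of_cyclotomics q"
proof -
  define as where "as = complex_roots_complex (map_poly complex_of_int q)"
  have q: "map_poly complex_of_int q = (\<Prod>a\<leftarrow>as. [:- a, 1:])"
    using complex_roots(1)[of "map_poly complex_of_int q"] assms by (simp add: as_def)
  have le: "\<forall>a\<in>set as. norm a \<le> 1"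
    using assms by (intro prod_list_max_1_le_1)
      (simp add: mahler_measure_def mahler_measure_poly_def as_def)
  have nz: "0 \<notin> set as"
  proof
    assume "0 \<in> set as"
    then have "poly (map_poly complex_of_int q) 0 = 0"
      unfolding q by (auto simp: poly_prod_list prod_list_zero_iff)
    then show False using assms(2) by (simp add: poly_0_coeff_0)
  qed
  obtain N where "N > 0" "\<forall>a\<in>set as. a ^ N = 1"
    using kronecker_roots_of_unity[OF q le nz] by blast
  then show ?thesis by (rule roots_of_unity_product_of_cyclotomics[OF q])
qed

lemma mahler_measure_product_of_cyclotomics:
  assumes "product_of_cyclotomics q"
  shows "mahler_measure q = 1"
proof -
  have one: "mahler_measure_poly 1 = 1" 
    by (subst one_pCons) (simp only: mahler_measure_constant norm_one)
  have "mahler_measure_poly (\<Prod>k\<in>A. [:- cis (t k), 1:]) = 1" if "finite A" for A :: "nat set" and t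
    using that
  proof (induction A)
    case (insert k A)
    have *: "mahler_measure_poly [:- cis (t k), 1:] = 1"
      using mahler_measure_poly_explicit[of 1 "[cis (t k)]"] by simp
    show ?case
      unfolding prod.insert[OF insert.hyps] measure_eq_prod by (simp only: insert.IH * mult_1)
  qed (simp add: one)
  then have cyc: "mahler_measure_poly (cyclotomic n) = 1" for n
    by (simp add: cyclotomic_def)
  obtain ns where ns: "map_poly of_int q = (\<Prod>n\<leftarrow>ns. cyclotomic n)"
    using assms by (auto simp: product_of_cyclotomics_def)
  have "mahler_measure_poly (\<Prod>n\<leftarrow>ns. cyclotomic n) = 1"
    by (induction ns) (simp_all add: one measure_eq_prod cyc)
  then show ?thesis by (simp add: mahler_measure_def ns)
qed

theorem theorem4p26:
  shows "Theta = inverse (theta 5) \<and>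
    (\<forall>\<beta>::real. \<beta> > 1 \<and> algebraic_int \<beta> \<and> mahler \<beta> < Theta \<longrightarrow> \<not> simple_Parry \<beta>) \<and>
    (\<forall>\<beta>::real. 1 < \<beta> \<and> \<beta> < 2 \<and> simple_Parry \<beta> \<longrightarrow>
      (mahler_measure (Parry_poly \<beta> div min_poly \<beta>) = 1 \<longleftrightarrow>
         product_of_cyclotomics (Parry_poly \<beta> div min_poly \<beta>)) \<and>
      (mahler_measure (Parry_poly \<beta> div min_poly \<beta>) = 1 \<longrightarrow>
         mahler \<beta> = mahler_measure (min_poly \<beta>) \<and>
         mahler_measure (min_poly \<beta>) = mahler_measure (Parry_poly \<beta>) \<and>
         mahler_measure (Parry_poly \<beta>) \<ge> Theta))"
proof (intro conjI allI impI)
  show "Theta = inverse (theta 5)" by (rule Theta_eq_inverse_theta)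
next
  fix \<beta> :: real
  assume "\<beta> > 1 \<and> algebraic_int \<beta> \<and> mahler \<beta> < Theta"
  then show "\<not> simple_Parry \<beta>" using simple_Parry_mahler_ge[of \<beta>] by auto
next
  fix \<beta> :: real
  assume "1 < \<beta> \<and> \<beta> < 2 \<and> simple_Parry \<beta>"
  then have \<beta>: "simple_Parry \<beta>" by simp
  note fac = simple_Parry_factorization[OF \<beta>]
  show "mahler_measure (Parry_poly \<beta> div min_poly \<beta>) = 1 \<longleftrightarrow>
      product_of_cyclotomics (Parry_poly \<beta> div min_poly \<beta>)"
    using kronecker_product_of_cyclotomics[OF fac(3,5)] mahler_measure_product_of_cyclotomics by blast
  show "mahler \<beta> = mahler_measure (min_poly \<beta>)" by (simp add: mahler_def)
  assume one: "mahler_measure (Parry_poly \<beta> div min_poly \<beta>) = 1"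
  have "mahler_measure (Parry_poly \<beta>)
      = mahler_measure (min_poly \<beta>) * mahler_measure (Parry_poly \<beta> div min_poly \<beta>)"
    by (subst fac(1)) (simp only: mahler_measure_def of_int_poly_hom.hom_mult measure_eq_prod)
  with one show eq: "mahler_measure (min_poly \<beta>) = mahler_measure (Parry_poly \<beta>)" by simp
  show "mahler_measure (Parry_poly \<beta>) \<ge> Theta"
    using simple_Parry_mahler_ge[OF \<beta>] by (simp add: mahler_def eq)
qed

end
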